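(* Let $k$ be a commutative unitary ring, $p,q$ units of $k$ with $pq\ne 1$, $\alpha$ a positive integer, $\epsilon_{ij}=\pm1$ for $1\le i<j\le\alpha$ with $\epsilon_{ii}=1$, $\epsilon_{ji}=\epsilon_{ij}$, and let $m,n\le\alpha$ be positive integers. The monomials formed by non-decreasing finite sequences (products $y_1\cdots y_r$, $r\ge0$, with $y_1\le\cdots\le y_r$, repetitions allowed) of elements of $$\mathcal{B}=\{Z_i^j\mid 1\le i\le n,\ 1\le j\le m\}$$ constitute a free basis of the $k$-module $M_{p,q,\epsilon}(n,m,k)=U(L_{p,q,\epsilon}(n,m,k))$.
   Context: **$L_{p,q,\epsilon}(n,m,k)$** is the free $k$-module with basis $\mathcal{B}=\{Z_i^j\mid 1\le i\le n,\ 1\le j\le m\}$, ordered by $Z_i^j>Z_u^v$ iff $i>u$, or $i=u$ and $j>v$. It carries $k$-linear maps $S,\langle,\rangle, T=S+\langle,\rangle:L\otimes_kL\to L\otimes_kL$ and the bracket $[,]=0$, where for $Z_i^l>Z_u^v$: $$\langle Z_i^l,Z_u^v\rangle=\begin{cases}\epsilon_{vl}(p-q^{-1})\,Z_i^v\otimes Z_u^l&\text{if } i>u,\ l>v,\\0&\text{otherwise,}\end{cases}$$ $$S(Z_i^l\otimes Z_u^v)=\begin{cases}\epsilon_{vl}\,p\,Z_u^v\otimes Z_i^l& i=u,\ l>v,\\ \epsilon_{ui}\,q\,Z_u^v\otimes Z_i^l& l=v,\ i>u,\\ \epsilon_{iu}\epsilon_{vl}\,p^{-1}q\,Z_u^v\otimes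 Z_i^l& i>u,\ v>l,\\ \epsilon_{vl}\epsilon_{ui}\,Z_u^v\otimes Z_i^l& i>u,\ l>v.\end{cases}$$ For $x\in\mathcal{B}$, $S(x\otimes x)=x\otimes x$ and $\langle x,x\rangle=0$; for the remaining pairs $S$ and $\langle,\rangle$ are determined by $S^2=Id$ and $\langle,\rangle S=-\langle,\rangle$. **$U(L)$** is the tensor $k$-algebra of $L$ modulo the two-sided ideal generated by $x\otimes y-T(x\otimes y)-[x,y]$, $x,y\in\mathcal{B}$. *)

theory Defs
  imports "HOL-Algebra.QuotRing" "HOL-Algebra.Module"
begin

text \<open>
  The scalars form a ring record \<open>R\<close>.  An element of the free module on a set \<open>X\<close> is a
  finitely supported coefficient function on the whole type of \<open>X\<close> that vanishes off \<open>X\<close>.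
\<close>

definition fin_supp :: "('a, 'c) ring_scheme \<Rightarrow> 'x set \<Rightarrow> ('x \<Rightarrow> 'a) set" where
  "fin_supp R X =
    {f. (\<forall>x. f x \<in> carrier R) \<and> finite {x. f x \<noteq> \<zero>\<^bsub>R\<^esub>} \<and> {x. f x \<noteq> \<zero>\<^bsub>R\<^esub>} \<subseteq> X}"

definition free_module :: "('a, 'c) ring_scheme \<Rightarrow> 'x set \<Rightarrow> ('a, 'x \<Rightarrow> 'a) module" where
  "free_module R X =
    \<lparr> carrier = fin_supp R X,
      mult = undefined, one = undefined,
      zero = (\<lambda>_. \<zero>\<^bsub>R\<^esub>), add = (\<lambda>f g x. f x \<oplus>\<^bsub>R\<^esub> g x),
      smult = (\<lambda>a f x. a \<otimes>\<^bsub>R\<^esub> f x) \<rparr>"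

definition single :: "('a, 'c) ring_scheme \<Rightarrow> 'x \<Rightarrow> 'x \<Rightarrow> 'a" where
  "single R x = (\<lambda>y. if y = x then \<one>\<^bsub>R\<^esub> else \<zero>\<^bsub>R\<^esub>)"

text \<open>The linear map from a free module to \<open>M\<close> with prescribed values on the basis elements.\<close>

definition lin_ext ::
    "('a, 'c) ring_scheme \<Rightarrow> ('a, 'b, 'd) module_scheme \<Rightarrow> ('x \<Rightarrow> 'b) \<Rightarrow> ('x \<Rightarrow> 'a) \<Rightarrow> 'b" where
  "lin_ext R M g f = (\<Oplus>\<^bsub>M\<^esub>x \<in> {x. f x \<noteq> \<zero>\<^bsub>R\<^esub>}. f x \<odot>\<^bsub>M\<^esub> g x)"

text \<open>
  A family \<open>b\<close> indexed by \<open>J\<close> is a free basis of the \<open>R\<close>-module \<open>M\<close> if every element of \<open>M\<close> is a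
  finite linear combination of it in exactly one way.  In particular, unless \<open>R\<close> is trivial,
  distinct indices give distinct elements.
\<close>

definition is_free_basis ::
    "('a, 'c) ring_scheme \<Rightarrow> ('a, 'b, 'd) module_scheme \<Rightarrow> 'j set \<Rightarrow> ('j \<Rightarrow> 'b) \<Rightarrow> bool" where
  "is_free_basis R M J b \<longleftrightarrow>
    module R M \<and> b \<in> J \<rightarrow> carrier M \<and>
    (\<forall>x \<in> carrier M. \<exists>!c. c \<in> fin_supp R J \<and>
       x = (\<Oplus>\<^bsub>M\<^esub>j \<in> {j. c j \<noteq> \<zero>\<^bsub>R\<^esub>}. c j \<odot>\<^bsub>M\<^esub> b j))"

text \<open>
  The tensor algebra of the free module on \<open>X\<close>.  Its component of degree \<open>r\<close> is free on
  the tensors of \<open>r\<close> elements of \<open>X\<close>, encoded as words of length \<open>r\<close>; multiplication extends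
  concatenation of words bilinearly.
\<close>

definition tensor_algebra ::
    "('a, 'c) ring_scheme \<Rightarrow> 'x set \<Rightarrow> ('a, 'x list \<Rightarrow> 'a) module" where
  "tensor_algebra R X =
    \<lparr> carrier = fin_supp R (lists X),
      mult = (\<lambda>f g w. \<Oplus>\<^bsub>R\<^esub>i \<in> {0..length w}. f (take i w) \<otimes>\<^bsub>R\<^esub> g (drop i w)),
      one = single R [],
      zero = (\<lambda>_. \<zero>\<^bsub>R\<^esub>), add = (\<lambda>f g w. f w \<oplus>\<^bsub>R\<^esub> g w),
      smult = (\<lambda>a f w. a \<otimes>\<^bsub>R\<^esub> f w) \<rparr>"

text \<open>
  With \<open>L\<close> the free module on \<open>X\<close>, the module \<open>L \<otimes> L\<close> is the free module on \<open>X \<times> X\<close>, the pair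
  \<open>(x, y)\<close> standing for \<open>x \<otimes> y\<close>.  The following maps embed \<open>L\<close> and \<open>L \<otimes> L\<close> into the tensor algebra.
\<close>

definition deg1 :: "('a, 'c) ring_scheme \<Rightarrow> ('x \<Rightarrow> 'a) \<Rightarrow> 'x list \<Rightarrow> 'a" where
  "deg1 R f = (\<lambda>w. case w of [x] \<Rightarrow> f x | _ \<Rightarrow> \<zero>\<^bsub>R\<^esub>)"

definition deg2 :: "('a, 'c) ring_scheme \<Rightarrow> ('x \<times> 'x \<Rightarrow> 'a) \<Rightarrow> 'x list \<Rightarrow> 'a" where
  "deg2 R t = (\<lambda>w. case w of [x, y] \<Rightarrow> t (x, y) | _ \<Rightarrow> \<zero>\<^bsub>R\<^esub>)"

text \<open>
  \<open>U(L)\<close> for \<open>L\<close> free on \<open>X\<close>, with \<open>T : L \<otimes> L \<rightarrow> L \<otimes> L\<close> and bracket \<open>br : L \<otimes> L \<rightarrow> L\<close>.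
\<close>

definition U_ideal ::
    "('a, 'c) ring_scheme \<Rightarrow> 'x set \<Rightarrow> (('x \<times> 'x \<Rightarrow> 'a) \<Rightarrow> 'x \<times> 'x \<Rightarrow> 'a) \<Rightarrow>
      (('x \<times> 'x \<Rightarrow> 'a) \<Rightarrow> 'x \<Rightarrow> 'a) \<Rightarrow> ('x list \<Rightarrow> 'a) set" where
  "U_ideal R X T br =
    (let A = tensor_algebra R X in
     Idl\<^bsub>A\<^esub> {deg2 R (single R (x, y)) \<ominus>\<^bsub>A\<^esub> deg2 R (T (single R (x, y)))
                 \<ominus>\<^bsub>A\<^esub> deg1 R (br (single R (x, y))) | x y. x \<in> X \<and> y \<in> X})"

text \<open>
  The quotient ring from the library, extended by the induced scalar multiplication on cosets.
\<close>

definition U_alg ::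
    "('a, 'c) ring_scheme \<Rightarrow> 'x set \<Rightarrow> (('x \<times> 'x \<Rightarrow> 'a) \<Rightarrow> 'x \<times> 'x \<Rightarrow> 'a) \<Rightarrow>
      (('x \<times> 'x \<Rightarrow> 'a) \<Rightarrow> 'x \<Rightarrow> 'a) \<Rightarrow> ('a, ('x list \<Rightarrow> 'a) set) module" where
  "U_alg R X T br =
    (let A = tensor_algebra R X; I = U_ideal R X T br in
     ring.extend (A Quot I)
       (module.fields (\<lambda>a C. \<Union>f \<in> C. I +>\<^bsub>A\<^esub> (a \<odot>\<^bsub>A\<^esub> f))))"

definition U_gen ::
    "('a, 'c) ring_scheme \<Rightarrow> 'x set \<Rightarrow> (('x \<times> 'x \<Rightarrow> 'a) \<Rightarrow> 'x \<times> 'x \<Rightarrow> 'a) \<Rightarrow>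
      (('x \<times> 'x \<Rightarrow> 'a) \<Rightarrow> 'x \<Rightarrow> 'a) \<Rightarrow> 'x \<Rightarrow> ('x list \<Rightarrow> 'a) set" where
  "U_gen R X T br x =
    U_ideal R X T br +>\<^bsub>tensor_algebra R X\<^esub> deg1 R (single R x)"

definition U_monomial ::
    "('a, 'c) ring_scheme \<Rightarrow> 'x set \<Rightarrow> (('x \<times> 'x \<Rightarrow> 'a) \<Rightarrow> 'x \<times> 'x \<Rightarrow> 'a) \<Rightarrow>
      (('x \<times> 'x \<Rightarrow> 'a) \<Rightarrow> 'x \<Rightarrow> 'a) \<Rightarrow> 'x list \<Rightarrow> ('x list \<Rightarrow> 'a) set" where
  "U_monomial R X T br ys =
    foldr (\<lambda>y z. U_gen R X T br y \<otimes>\<^bsub>U_alg R X T br\<^esub> z) ys \<one>\<^bsub>U_alg R X T br\<^esub>"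


text \<open>The generator \<open>Z\<^sub>i\<^sup>j\<close>, with lower index \<open>i\<close> and upper index \<open>j\<close>, is the pair \<open>(i, j)\<close>.\<close>

type_synonym gen = "nat \<times> nat"

definition Z_basis :: "nat \<Rightarrow> nat \<Rightarrow> gen set" where
  "Z_basis n m = {1..n} \<times> {1..m}"

fun Z_less :: "gen \<Rightarrow> gen \<Rightarrow> bool" where
  "Z_less (u, v) (i, l) \<longleftrightarrow> i > u \<or> (i = u \<and> l > v)"

definition Z_nondecreasing :: "nat \<Rightarrow> nat \<Rightarrow> gen list set" where
  "Z_nondecreasing n m =
    {ys \<in> lists (Z_basis n m). sorted_wrt (\<lambda>x y. x = y \<or> Z_less x y) ys}"

text \<open>
  For \<open>z > w\<close>, \<open>S(z \<otimes> w) = S_coeff z w \<cdot> (w \<otimes> z)\<close>.  Then \<open>S\<^sup>2 = Id\<close> forces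
  \<open>S(w \<otimes> z) = (S_coeff z w)\<^sup>-\<^sup>1 \<cdot> (z \<otimes> w)\<close>, and \<open>\<langle>,\<rangle>S = -\<langle>,\<rangle>\<close> forces
  \<open>\<langle>w, z\<rangle> = -(S_coeff z w)\<^sup>-\<^sup>1 \<cdot> \<langle>z, w\<rangle>\<close>.
\<close>

fun S_coeff ::
    "('a, 'c) ring_scheme \<Rightarrow> 'a \<Rightarrow> 'a \<Rightarrow> (nat \<Rightarrow> nat \<Rightarrow> 'a) \<Rightarrow> gen \<Rightarrow> gen \<Rightarrow> 'a" where
  "S_coeff R p q \<epsilon> (i, l) (u, v) =
    (if i = u then \<epsilon> v l \<otimes>\<^bsub>R\<^esub> p
     else if l = v then \<epsilon> u i \<otimes>\<^bsub>R\<^esub> q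
     else if v > l then \<epsilon> i u \<otimes>\<^bsub>R\<^esub> \<epsilon> v l \<otimes>\<^bsub>R\<^esub> inv\<^bsub>R\<^esub> p \<otimes>\<^bsub>R\<^esub> q
     else \<epsilon> v l \<otimes>\<^bsub>R\<^esub> \<epsilon> u i)"

fun pair_pos ::
    "('a, 'c) ring_scheme \<Rightarrow> 'a \<Rightarrow> 'a \<Rightarrow> (nat \<Rightarrow> nat \<Rightarrow> 'a) \<Rightarrow> gen \<Rightarrow> gen \<Rightarrow> gen \<times> gen \<Rightarrow> 'a" where
  "pair_pos R p q \<epsilon> (i, l) (u, v) =
    (if i > u \<and> l > v
     then (\<epsilon> v l \<otimes>\<^bsub>R\<^esub> (p \<ominus>\<^bsub>R\<^esub> inv\<^bsub>R\<^esub> q)) \<odot>\<^bsub>free_module R UNIV\<^esub> single R ((i, v), (u, l))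
     else \<zero>\<^bsub>free_module R UNIV\<^esub>)"

definition S_on_basis ::
    "('a, 'c) ring_scheme \<Rightarrow> 'a \<Rightarrow> 'a \<Rightarrow> (nat \<Rightarrow> nat \<Rightarrow> 'a) \<Rightarrow> gen \<times> gen \<Rightarrow> gen \<times> gen \<Rightarrow> 'a" where
  "S_on_basis R p q \<epsilon> = (\<lambda>(x, y).
    if x = y then single R (x, x)
    else if Z_less y x then S_coeff R p q \<epsilon> x y \<odot>\<^bsub>free_module R UNIV\<^esub> single R (y, x)
    else inv\<^bsub>R\<^esub> (S_coeff R p q \<epsilon> y x) \<odot>\<^bsub>free_module R UNIV\<^esub> single R (y, x))"

definition pair_on_basis ::
    "('a, 'c) ring_scheme \<Rightarrow> 'a \<Rightarrow> 'a \<Rightarrow> (nat \<Rightarrow> nat \<Rightarrow> 'a) \<Rightarrow> gen \<times> gen \<Rightarrow> gen \<times> gen \<Rightarrow> 'a" where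
  "pair_on_basis R p q \<epsilon> = (\<lambda>(x, y).
    if x = y then \<zero>\<^bsub>free_module R UNIV\<^esub>
    else if Z_less y x then pair_pos R p q \<epsilon> x y
    else (\<ominus>\<^bsub>R\<^esub> (inv\<^bsub>R\<^esub> (S_coeff R p q \<epsilon> y x))) \<odot>\<^bsub>free_module R UNIV\<^esub> pair_pos R p q \<epsilon> y x)"

definition S_map ::
    "('a, 'c) ring_scheme \<Rightarrow> 'a \<Rightarrow> 'a \<Rightarrow> (nat \<Rightarrow> nat \<Rightarrow> 'a) \<Rightarrow> nat \<Rightarrow> nat \<Rightarrow>
      (gen \<times> gen \<Rightarrow> 'a) \<Rightarrow> gen \<times> gen \<Rightarrow> 'a" where
  "S_map R p q \<epsilon> n m =
    lin_ext R (free_module R (Z_basis n m \<times> Z_basis n m)) (S_on_basis R p q \<epsilon>)"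

definition pair_map ::
    "('a, 'c) ring_scheme \<Rightarrow> 'a \<Rightarrow> 'a \<Rightarrow> (nat \<Rightarrow> nat \<Rightarrow> 'a) \<Rightarrow> nat \<Rightarrow> nat \<Rightarrow>
      (gen \<times> gen \<Rightarrow> 'a) \<Rightarrow> gen \<times> gen \<Rightarrow> 'a" where
  "pair_map R p q \<epsilon> n m =
    lin_ext R (free_module R (Z_basis n m \<times> Z_basis n m)) (pair_on_basis R p q \<epsilon>)"

definition T_map ::
    "('a, 'c) ring_scheme \<Rightarrow> 'a \<Rightarrow> 'a \<Rightarrow> (nat \<Rightarrow> nat \<Rightarrow> 'a) \<Rightarrow> nat \<Rightarrow> nat \<Rightarrow>
      (gen \<times> gen \<Rightarrow> 'a) \<Rightarrow> gen \<times> gen \<Rightarrow> 'a" where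
  "T_map R p q \<epsilon> n m t =
    S_map R p q \<epsilon> n m t \<oplus>\<^bsub>free_module R (Z_basis n m \<times> Z_basis n m)\<^esub> pair_map R p q \<epsilon> n m t"

definition zero_bracket ::
    "('a, 'c) ring_scheme \<Rightarrow> nat \<Rightarrow> nat \<Rightarrow> (gen \<times> gen \<Rightarrow> 'a) \<Rightarrow> gen \<Rightarrow> 'a" where
  "zero_bracket R n m t = \<zero>\<^bsub>free_module R (Z_basis n m)\<^esub>"

definition M_alg ::
    "('a, 'c) ring_scheme \<Rightarrow> 'a \<Rightarrow> 'a \<Rightarrow> (nat \<Rightarrow> nat \<Rightarrow> 'a) \<Rightarrow> nat \<Rightarrow> nat \<Rightarrow>
      ('a, (gen list \<Rightarrow> 'a) set) module" where
  "M_alg R p q \<epsilon> n m =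
    U_alg R (Z_basis n m) (T_map R p q \<epsilon> n m) (zero_bracket R n m)"

definition M_monomial ::
    "('a, 'c) ring_scheme \<Rightarrow> 'a \<Rightarrow> 'a \<Rightarrow> (nat \<Rightarrow> nat \<Rightarrow> 'a) \<Rightarrow> nat \<Rightarrow> nat \<Rightarrow>
      gen list \<Rightarrow> (gen list \<Rightarrow> 'a) set" where
  "M_monomial R p q \<epsilon> n m =
    U_monomial R (Z_basis n m) (T_map R p q \<epsilon> n m) (zero_bracket R n m)"


lemma fin_supp_add:
  assumes "cring R" "f \<in> fin_supp R X" "g \<in> fin_supp R X"
  shows "(\<lambda>x. f x \<oplus>\<^bsub>R\<^esub> g x) \<in> fin_supp R X"
proof -
  interpret cring R by fact
  have "{x. f x \<oplus>\<^bsub>R\<^esub> g x \<noteq> \<zero>\<^bsub>R\<^esub>} \<subseteq> {x. f x \<noteq> \<zero>\<^bsub>R\<^esub>} \<union> {x. g x \<noteq> \<zero>\<^bsub>R\<^esub>}" by auto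
  then show ?thesis using assms(2,3) unfolding fin_supp_def
    by (auto intro: finite_subset)
qed

lemma fin_supp_smult:
  assumes "cring R" "a \<in> carrier R" "f \<in> fin_supp R X"
  shows "(\<lambda>x. a \<otimes>\<^bsub>R\<^esub> f x) \<in> fin_supp R X"
proof -
  interpret cring R by fact
  have "{x. a \<otimes>\<^bsub>R\<^esub> f x \<noteq> \<zero>\<^bsub>R\<^esub>} \<subseteq> {x. f x \<noteq> \<zero>\<^bsub>R\<^esub>}" using assms(2) by auto
  then show ?thesis using assms(2,3) unfolding fin_supp_def
    by (auto intro: finite_subset)
qed

lemma fin_supp_closed: "f \<in> fin_supp R X \<Longrightarrow> f x \<in> carrier R"
  by (simp add: fin_supp_def)

lemma fin_supp_zero: "cring R \<Longrightarrow> (\<lambda>_. \<zero>\<^bsub>R\<^esub>) \<in> fin_supp R X"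
  by (simp add: fin_supp_def cring.cring_simprules)

lemma module_free_module:
  assumes "cring R"
  shows "module R (free_module R X)"
proof -
  interpret cring R by fact
  have ex: "\<exists>g \<in> fin_supp R X. (\<lambda>x. g x \<oplus>\<^bsub>R\<^esub> f x) = (\<lambda>_. \<zero>\<^bsub>R\<^esub>)" if "f \<in> fin_supp R X" for f
  proof (rule bexI[of _ "\<lambda>x. (\<ominus>\<^bsub>R\<^esub> \<one>\<^bsub>R\<^esub>) \<otimes>\<^bsub>R\<^esub> f x"])
    show "(\<lambda>x. (\<ominus>\<^bsub>R\<^esub> \<one>\<^bsub>R\<^esub>) \<otimes>\<^bsub>R\<^esub> f x) \<in> fin_supp R X" by (rule fin_supp_smult) (auto simp: assms that)
    show "(\<lambda>x. (\<ominus>\<^bsub>R\<^esub> \<one>\<^bsub>R\<^esub>) \<otimes>\<^bsub>R\<^esub> f x \<oplus>\<^bsub>R\<^esub> f x) = (\<lambda>_. \<zero>\<^bsub>R\<^esub>)"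
      using fin_supp_closed[OF that] by (simp add: l_minus l_neg)
  qed
  have grp: "abelian_group (free_module R X)"
  proof (rule abelian_groupI)
    fix f assume "f \<in> carrier (free_module R X)"
    then show "\<exists>g \<in> carrier (free_module R X). g \<oplus>\<^bsub>free_module R X\<^esub> f = \<zero>\<^bsub>free_module R X\<^esub>"
      using ex[of f] by (simp add: free_module_def)
  qed (simp_all add: free_module_def fin_supp_add fin_supp_zero assms fin_supp_closed a_ac fun_eq_iff)
  show ?thesis
    by (rule moduleI[OF assms grp])
      (simp_all add: free_module_def fin_supp_smult assms fin_supp_closed l_distr r_distr m_assoc fun_eq_iff)
qed

lemma free_module_minus_equality:
  assumes "cring R" "f \<in> fin_supp R X" "g \<in> fin_supp R X" "\<And>x. g x \<oplus>\<^bsub>R\<^esub> f x = \<zero>\<^bsub>R\<^esub>"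
  shows "g = \<ominus>\<^bsub>free_module R X\<^esub> f"
proof -
  interpret F: module R "free_module R X" using assms(1) by (rule module_free_module)
  show ?thesis
    by (rule F.M.minus_equality[symmetric]) (use assms in \<open>auto simp: free_module_def\<close>)
qed

lemma finsum_free_module:
  assumes "cring R" "finite A" "g \<in> A \<rightarrow> fin_supp R X"
  shows "(\<Oplus>\<^bsub>free_module R X\<^esub>a \<in> A. g a) = (\<lambda>x. \<Oplus>\<^bsub>R\<^esub>a \<in> A. g a x)"
proof -
  interpret cring R by fact
  interpret F: module R "free_module R X" using assms(1) by (rule module_free_module)
  show ?thesis using assms(2,3)
  proof (induction A rule: finite_induct)
    case empty
    show ?case unfolding F.M.finsum_empty by (simp add: free_module_def)
  next
    case (insert a A)
    have "(\<Oplus>\<^bsub>free_module R X\<^esub>a \<in> insert a A. g a)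
       = g a \<oplus>\<^bsub>free_module R X\<^esub> (\<Oplus>\<^bsub>free_module R X\<^esub>a \<in> A. g a)"
      using insert by (intro F.M.finsum_insert) (auto simp: free_module_def)
    also have "\<dots> = (\<lambda>x. g a x \<oplus>\<^bsub>R\<^esub> (\<Oplus>\<^bsub>R\<^esub>a \<in> A. g a x))"
      using insert by (auto simp: free_module_def)
    also have "\<dots> = (\<lambda>x. \<Oplus>\<^bsub>R\<^esub>a \<in> insert a A. g a x)"
      using insert by (intro ext finsum_insert[symmetric]) (auto simp: fin_supp_closed Pi_iff)
    finally show ?case .
  qed
qed

lemma lin_ext_free_module:
  assumes "cring R" "finite X" "f \<in> fin_supp R X" "g \<in> X \<rightarrow> fin_supp R Y"
  shows "lin_ext R (free_module R Y) g f = (\<lambda>y. \<Oplus>\<^bsub>R\<^esub>x \<in> X. f x \<otimes>\<^bsub>R\<^esub> g x y)"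
proof -
  interpret cring R by fact
  have fin: "finite {x. f x \<noteq> \<zero>\<^bsub>R\<^esub>}" and sub: "{x. f x \<noteq> \<zero>\<^bsub>R\<^esub>} \<subseteq> X"
    using assms(3) by (auto simp: fin_supp_def)
  have g: "x \<in> X \<Longrightarrow> g x y \<in> carrier R" for x y using assms(4) by (auto intro: fin_supp_closed)
  have "lin_ext R (free_module R Y) g f =
      (\<lambda>y. \<Oplus>\<^bsub>R\<^esub>x \<in> {x. f x \<noteq> \<zero>\<^bsub>R\<^esub>}. (f x \<odot>\<^bsub>free_module R Y\<^esub> g x) y)"
    unfolding lin_ext_def
    by (rule finsum_free_module[OF assms(1) fin])
      (use sub assms(4) in \<open>auto simp: free_module_def intro!: fin_supp_smult[OF assms(1)] fin_supp_closed[OF assms(3)]\<close>)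
  also have "\<dots> = (\<lambda>y. \<Oplus>\<^bsub>R\<^esub>x \<in> X. f x \<otimes>\<^bsub>R\<^esub> g x y)"
    using sub assms(2) g fin_supp_closed[OF assms(3)]
    by (intro ext add.finprod_mono_neutral_cong_left) (auto simp: free_module_def)
  finally show ?thesis .
qed

lemma lin_ext_closed:
  assumes "cring R" "finite X" "f \<in> fin_supp R X" "g \<in> X \<rightarrow> fin_supp R Y"
  shows "lin_ext R (free_module R Y) g f \<in> fin_supp R Y"
proof -
  interpret F: module R "free_module R Y" using assms(1) by (rule module_free_module)
  have "lin_ext R (free_module R Y) g f \<in> carrier (free_module R Y)"
    unfolding lin_ext_def
    by (rule F.M.finsum_closed)
      (use assms in \<open>auto simp: free_module_def fin_supp_def[of R X] intro!: fin_supp_smult\<close>)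
  then show ?thesis by (simp add: free_module_def)
qed


text \<open>The maps \<open>S\<close> and \<open>\<langle>,\<rangle>\<close> satisfy \<open>S\<^sup>2 = Id\<close> and \<open>\<langle>,\<rangle>S = -\<langle>,\<rangle>\<close>.\<close>

text \<open>The hypothesis on \<open>\<epsilon>\<close> is weaker than \<open>\<epsilon>\<^sub>i\<^sub>j = \<plusminus>1\<close>.\<close>

locale Z_data = cring R for R :: "('a, 'c) ring_scheme" (structure) +
  fixes p q :: 'a and \<epsilon> :: "nat \<Rightarrow> nat \<Rightarrow> 'a" and n m :: nat
  assumes p: "p \<in> Units R" and q: "q \<in> Units R"
    and \<epsilon>: "\<And>i j. 1 \<le> i \<Longrightarrow> i \<le> max n m \<Longrightarrow> 1 \<le> j \<Longrightarrow> j \<le> max n m \<Longrightarrow> \<epsilon> i j \<in> Units R"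
begin

abbreviation "BB \<equiv> Z_basis n m \<times> Z_basis n m"

definition S_scalar :: "gen \<times> gen \<Rightarrow> 'a" where
  "S_scalar = (\<lambda>(x, y). if x = y then \<one> else if Z_less y x then S_coeff R p q \<epsilon> x y
     else inv (S_coeff R p q \<epsilon> y x))"

lemma S_coeff_Units:
  assumes "(x, y) \<in> BB"
  shows "S_coeff R p q \<epsilon> x y \<in> Units R"
proof -
  obtain i l u v where xy: "x = (i, l)" "y = (u, v)" by fastforce
  have "\<epsilon> v l \<in> Units R" "\<epsilon> u i \<in> Units R" "\<epsilon> i u \<in> Units R"
    using assms by (auto simp: xy Z_basis_def intro!: \<epsilon>)
  then show ?thesis using p q by (simp add: xy)
qed

declare S_coeff.simps [simp del]

lemma S_scalar_Units: "z \<in> BB \<Longrightarrow> S_scalar z \<in> Units R"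
  by (auto simp: S_scalar_def intro!: S_coeff_Units Units_inv_Units)

lemma Z_less_total: "x \<noteq> y \<Longrightarrow> Z_less x y \<longleftrightarrow> \<not> Z_less y x"
  by (cases x; cases y) auto

lemma S_scalar_swap: "(x, y) \<in> BB \<Longrightarrow> S_scalar (x, y) \<otimes> S_scalar (y, x) = \<one>"
  using S_coeff_Units[of x y] S_coeff_Units[of y x]
  by (auto simp: S_scalar_def Z_less_total[of x y] Units_closed)

lemma S_on_basis_eq:
  "z \<in> BB \<Longrightarrow> S_on_basis R p q \<epsilon> z = (\<lambda>w. if w = prod.swap z then S_scalar z else \<zero>)"
  using S_scalar_Units[of z, THEN Units_closed]
  by (auto simp: S_on_basis_def S_scalar_def single_def free_module_def fun_eq_iff split: prod.splits)

lemma S_on_basis_closed: "S_on_basis R p q \<epsilon> \<in> BB \<rightarrow> fin_supp R BB"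
proof
  fix z assume z: "z \<in> BB"
  have sub: "{w. (if w = prod.swap z then S_scalar z else \<zero>) \<noteq> \<zero>} \<subseteq> {prod.swap z}" by auto
  have "finite {w. (if w = prod.swap z then S_scalar z else \<zero>) \<noteq> \<zero>}"
    using sub by (rule finite_subset) simp
  moreover have "prod.swap z \<in> BB" using z by auto
  ultimately show "S_on_basis R p q \<epsilon> z \<in> fin_supp R BB"
    using sub S_scalar_Units[OF z, THEN Units_closed]
    unfolding S_on_basis_eq[OF z] fin_supp_def by (simp del: split_paired_All mem_Sigma_iff) blast
qed

lemma finite_BB: "finite BB" by (simp add: Z_basis_def)

lemma S_map_closed: "t \<in> fin_supp R BB \<Longrightarrow> S_map R p q \<epsilon> n m t \<in> fin_supp R BB"
  unfolding S_map_def by (rule lin_ext_closed[OF is_cring finite_BB _ S_on_basis_closed])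

lemma S_map_apply:
  assumes "t \<in> fin_supp R BB" "z \<in> BB"
  shows "S_map R p q \<epsilon> n m t z = S_scalar (prod.swap z) \<otimes> t (prod.swap z)"
proof -
  have zs: "prod.swap z \<in> BB" using assms(2) by auto
  have "S_map R p q \<epsilon> n m t z = (\<Oplus>x \<in> BB. t x \<otimes> S_on_basis R p q \<epsilon> x z)"
    unfolding S_map_def using lin_ext_free_module[OF is_cring finite_BB assms(1) S_on_basis_closed] by simp
  also have "\<dots> = (\<Oplus>x \<in> BB. if prod.swap z = x then S_scalar x \<otimes> t x else \<zero>)"
  proof (rule finsum_cong')
    fix x assume x: "x \<in> BB"
    have "z = prod.swap x \<longleftrightarrow> prod.swap z = x" by auto
    then show "t x \<otimes> S_on_basis R p q \<epsilon> x z = (if prod.swap z = x then S_scalar x \<otimes> t x else \<zero>)"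
      using S_scalar_Units[OF x, THEN Units_closed] fin_supp_closed[OF assms(1), of x]
      by (simp add: S_on_basis_eq[OF x] m_comm)
  next
    show "(\<lambda>x. if prod.swap z = x then S_scalar x \<otimes> t x else \<zero>) \<in> BB \<rightarrow> carrier R"
    proof
      fix x assume x: "x \<in> BB"
      have "S_scalar x \<otimes> t x \<in> carrier R"
        by (intro m_closed Units_closed[OF S_scalar_Units[OF x]] fin_supp_closed[OF assms(1)])
      then show "(if prod.swap z = x then S_scalar x \<otimes> t x else \<zero>) \<in> carrier R" by simp
    qed
  qed (rule refl)
  also have "\<dots> = S_scalar (prod.swap z) \<otimes> t (prod.swap z)"
    by (intro finsum_singleton[OF zs finite_BB] Pi_I m_closed Units_closed[OF S_scalar_Units]
        fin_supp_closed[OF assms(1)])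
  finally show ?thesis .
qed

lemma S_map_involution:
  assumes "t \<in> carrier (free_module R BB)"
  shows "S_map R p q \<epsilon> n m (S_map R p q \<epsilon> n m t) = t"
proof
  fix z
  have t: "t \<in> fin_supp R BB" using assms by (simp add: free_module_def)
  show "S_map R p q \<epsilon> n m (S_map R p q \<epsilon> n m t) z = t z"
  proof (cases "z \<in> BB")
    case True
    then have zs: "prod.swap z \<in> BB" by auto
    have "S_scalar (prod.swap z) \<otimes> S_scalar z = \<one>"
      using S_scalar_swap[of "snd z" "fst z"] zs by (simp add: prod.swap_def)
    then have "S_scalar (prod.swap z) \<otimes> (S_scalar z \<otimes> t z) = t z"
      using fin_supp_closed[OF t, of z]
        S_scalar_Units[OF True, THEN Units_closed] S_scalar_Units[OF zs, THEN Units_closed]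
      by (simp add: m_assoc[symmetric])
    then show ?thesis
      using S_map_apply[OF S_map_closed[OF t] True] S_map_apply[OF t zs] by simp
  next
    case False
    have nz: "f z = \<zero>" if "f \<in> fin_supp R BB" for f :: "gen \<times> gen \<Rightarrow> 'a"
      using that False unfolding fin_supp_def by blast
    show ?thesis using nz[OF S_map_closed[OF S_map_closed[OF t]]] nz[OF t] by simp
  qed
qed

lemma pair_pos_closed:
  assumes "(x, y) \<in> BB"
  shows "pair_pos R p q \<epsilon> x y \<in> fin_supp R BB"
proof -
  have 1: "single R z \<in> fin_supp R BB" if "z \<in> BB" for z
    using that by (auto simp: single_def fin_supp_def)
  obtain i l u v where xy: "x = (i, l)" "y = (u, v)" by fastforce
  have "\<epsilon> v l \<otimes> (p \<ominus> inv q) \<in> carrier R" if "l > v"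
    using assms p q that Units_closed[OF \<epsilon>[of v l]]
    by (auto simp: xy Z_basis_def Units_closed)
  moreover have "((i, v), (u, l)) \<in> BB" using assms by (simp add: xy Z_basis_def)
  ultimately have "u < i \<and> v < l \<Longrightarrow>
      (\<lambda>w. (\<epsilon> v l \<otimes> (p \<ominus> inv q)) \<otimes> single R ((i, v), (u, l)) w) \<in> fin_supp R BB"
    by (intro fin_supp_smult[OF is_cring] 1) auto
  then show ?thesis by (simp add: xy free_module_def fin_supp_zero[OF is_cring] del: mem_Sigma_iff)
qed

declare pair_pos.simps [simp del]

lemma pair_on_basis_closed: "pair_on_basis R p q \<epsilon> \<in> BB \<rightarrow> fin_supp R BB"
proof
  fix z assume z: "z \<in> BB"
  obtain x y where xy: "z = (x, y)" by (rule prod.exhaust)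
  have *: "(x, y) \<in> BB" "(y, x) \<in> BB" using z xy by auto
  have "(\<lambda>w. (\<ominus> (inv (S_coeff R p q \<epsilon> y x))) \<otimes> pair_pos R p q \<epsilon> y x w) \<in> fin_supp R BB"
    using S_coeff_Units[OF *(2)] pair_pos_closed[OF *(2)]
    by (intro fin_supp_smult[OF is_cring]) auto
  then show "pair_on_basis R p q \<epsilon> z \<in> fin_supp R BB"
    using pair_pos_closed[OF *(1)]
    by (simp add: xy pair_on_basis_def free_module_def fin_supp_zero[OF is_cring] del: mem_Sigma_iff)
qed

lemma pair_on_basis_swap:
  assumes "z \<in> BB"
  shows "S_scalar z \<otimes> pair_on_basis R p q \<epsilon> (prod.swap z) w = \<ominus> pair_on_basis R p q \<epsilon> z w"
proof -
  obtain x y where z: "z = (x, y)" by (rule prod.exhaust)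
  have xy: "(x, y) \<in> BB" "(y, x) \<in> BB" using assms z by auto
  note c = S_coeff_Units[OF xy(1)] S_coeff_Units[OF xy(2)]
    fin_supp_closed[OF pair_pos_closed[OF xy(1)], of w] fin_supp_closed[OF pair_pos_closed[OF xy(2)], of w]
  have c': "S_coeff R p q \<epsilon> x y \<otimes> (inv (S_coeff R p q \<epsilon> x y) \<otimes> a) = a" if "a \<in> carrier R" for a
    using c that by (simp add: m_assoc[symmetric] Units_closed)
  show ?thesis
  proof (cases "x = y")
    case True
    then show ?thesis by (simp add: z pair_on_basis_def S_scalar_def free_module_def)
  next
    case False
    then show ?thesis using c c' Z_less_total[OF False]
      by (simp add: z pair_on_basis_def S_scalar_def free_module_def l_minus r_minus m_closed Units_closed)
  qed
qed

lemma pair_map_S_map: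
  assumes "t \<in> carrier (free_module R BB)"
  shows "pair_map R p q \<epsilon> n m (S_map R p q \<epsilon> n m t) =
    \<ominus>\<^bsub>free_module R BB\<^esub> pair_map R p q \<epsilon> n m t"
proof -
  have t: "t \<in> fin_supp R BB" using assms by (simp add: free_module_def)
  let ?P = "pair_on_basis R p q \<epsilon>"
  have P: "?P z w \<in> carrier R" if "z \<in> BB" for z w
    using pair_on_basis_closed that by (auto intro: fin_supp_closed)
  have pm: "pair_map R p q \<epsilon> n m f = (\<lambda>w. \<Oplus>z \<in> BB. f z \<otimes> ?P z w)" if "f \<in> fin_supp R BB" for f
    unfolding pair_map_def by (rule lin_ext_free_module[OF is_cring finite_BB that pair_on_basis_closed])
  have tc: "t z \<in> carrier R" for z using fin_supp_closed[OF t] .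
  have sc: "S_scalar z \<in> carrier R" if "z \<in> BB" for z using S_scalar_Units[OF that] by (rule Units_closed)
  have inj: "inj_on prod.swap BB" by (auto simp: inj_on_def)
  have im: "prod.swap ` BB = BB" by (auto simp: image_iff)
  have "pair_map R p q \<epsilon> n m (S_map R p q \<epsilon> n m t) w \<oplus> pair_map R p q \<epsilon> n m t w = \<zero>" for w
  proof -
    have "(\<Oplus>z \<in> BB. S_map R p q \<epsilon> n m t z \<otimes> ?P z w)
        = (\<Oplus>z \<in> prod.swap ` BB. S_map R p q \<epsilon> n m t z \<otimes> ?P z w)" by (simp only: im)
    also have "\<dots> = (\<Oplus>z \<in> BB. S_map R p q \<epsilon> n m t (prod.swap z) \<otimes> ?P (prod.swap z) w)"
      by (rule finsum_reindex[OF _ inj], unfold im) (intro Pi_I m_closed P fin_supp_closed[OF S_map_closed[OF t]])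
    also have "\<dots> = (\<Oplus>z \<in> BB. \<ominus> (t z \<otimes> ?P z w))"
    proof (rule finsum_cong')
      fix z assume z: "z \<in> BB"
      then have zs: "prod.swap z \<in> BB" by auto
      have "S_map R p q \<epsilon> n m t (prod.swap z) \<otimes> ?P (prod.swap z) w
          = t z \<otimes> (S_scalar z \<otimes> ?P (prod.swap z) w)"
        using S_map_apply[OF t zs] sc[OF z] tc[of z] P[OF zs, of w] by (simp add: m_ac)
      then show "S_map R p q \<epsilon> n m t (prod.swap z) \<otimes> ?P (prod.swap z) w = \<ominus> (t z \<otimes> ?P z w)"
        using pair_on_basis_swap[OF z, of w] tc P[OF z] by (simp add: r_minus)
    qed (rule refl, intro Pi_I a_inv_closed m_closed P tc)
    finally have "(\<Oplus>z \<in> BB. S_map R p q \<epsilon> n m t z \<otimes> ?P z w) = (\<Oplus>z \<in> BB. \<ominus> (t z \<otimes> ?P z w))" .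
    moreover have "(\<Oplus>z \<in> BB. \<ominus> (t z \<otimes> ?P z w)) \<oplus> (\<Oplus>z \<in> BB. t z \<otimes> ?P z w)
        = (\<Oplus>z \<in> BB. \<ominus> (t z \<otimes> ?P z w) \<oplus> t z \<otimes> ?P z w)"
      by (rule finsum_addf[symmetric]; intro Pi_I a_inv_closed m_closed P tc)
    moreover have "\<dots> = (\<Oplus>z \<in> BB. \<zero>)"
      by (rule finsum_cong'[OF refl]) (simp, intro l_neg m_closed P tc)
    ultimately show ?thesis unfolding pm[OF t] pm[OF S_map_closed[OF t]] by simp
  qed
  moreover have "pair_map R p q \<epsilon> n m f \<in> fin_supp R BB" if "f \<in> fin_supp R BB" for f
    unfolding pair_map_def by (rule lin_ext_closed[OF is_cring finite_BB that pair_on_basis_closed])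
  ultimately show ?thesis
    using t S_map_closed[OF t] by (intro free_module_minus_equality[OF is_cring])
qed

end

end

theory Submission
  imports Defs "HOL-Library.Product_Lexorder"
begin

text \<open>
  The defining relations are read as rewriting rules \<open>x y \<rightarrow> c y x + d a b\<close> for \<open>x > y\<close>, where
  \<open>a < x\<close>, so that every rule lowers a word in the length-lexicographic order.  By the diamond lemma
  the sorted words are a basis as soon as the overlaps \<open>x y z\<close> with \<open>x > y > z\<close> are confluent.  An
  overlap involves at most three rows and three columns, which leaves 24 configurations.  In 20 of
  them both reductions give the same monomials; the other four are settled by the relation
  \<open>q = p\<^sup>-\<^sup>1 + (p - q\<^sup>-\<^sup>1) p\<^sup>-\<^sup>1 q\<close>.
\<close>

text \<open>Over an arbitrary commutative ring no dimension count is available. Independence of the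
  sorted words therefore comes from linear functionals that vanish on the ideal and read off
  coefficients: the numbers \<open>nf w s\<close>, extended linearly in \<open>w\<close>.
  Accordingly confluence is phrased for scalar-valued functions \<open>f\<close> instead of formal
  combinations of words, so that resolving an overlap means proving an identity in the ground ring.

  One rule for each pair x > y suffices. The conditions S^2 = Id and <,>S = -<,> make the relation
  of (y, x) a unit multiple of the relation of (x, y), and the relation of (x, x) is zero.

  The relation that closes the four exceptional overlaps is the definition of p - q^-1 multiplied by
  p^-1 q. It is used exactly in four overlaps that meet two rows and three columns, or three rows
  and two columns.\<close>

lemma fin_supp_single: "cring R \<Longrightarrow> x \<in> X \<Longrightarrow> single R x \<in> fin_supp R X"
  by (auto simp: fin_supp_def single_def cring.cring_simprules)

lemma single_closed: "cring R \<Longrightarrow> single R x y \<in> carrier R"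
  by (auto simp: single_def cring.cring_simprules)

lemma fin_supp_mono: "f \<in> fin_supp R X \<Longrightarrow> X \<subseteq> Y \<Longrightarrow> f \<in> fin_supp R Y"
  by (auto simp: fin_supp_def)

section \<open>Finitely supported functions and linear functionals on them\<close>

context cring
begin

lemma fin_supp_uminus: "f \<in> fin_supp R X \<Longrightarrow> (\<lambda>x. \<ominus> f x) \<in> fin_supp R X"
  using fin_supp_smult[OF is_cring, of "\<ominus> \<one>" f X] fin_supp_closed[of f R X] by (simp add: l_minus)

text \<open>Linear statements need to be checked on basis elements only. The \<open>add\<close> case
  puts no condition on \<open>f x\<close>, so it is literally compatibility with addition, scalars
  and \<open>single\<close>.\<close>

lemma fin_supp_induct [consumes 1, case_names zero add]:
  assumes "f \<in> fin_supp R X" and zero: "P (\<lambda>_. \<zero>)"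
    and add: "\<And>f a x. f \<in> fin_supp R X \<Longrightarrow> a \<in> carrier R \<Longrightarrow> x \<in> X \<Longrightarrow> P f
      \<Longrightarrow> P (\<lambda>y. f y \<oplus> a \<otimes> single R x y)"
  shows "P f"
proof -
  have "P f" if "finite S" "f \<in> fin_supp R X" "{x. f x \<noteq> \<zero>} \<subseteq> S" for S f
    using that
  proof (induction S arbitrary: f rule: finite_induct)
    case empty
    then have "f = (\<lambda>_. \<zero>)" by auto
    then show ?case using zero by simp
  next
    case (insert x S)
    note fc = fin_supp_closed[OF insert.prems(1)]
    show ?case
    proof (cases "f x = \<zero>")
      case True
      then show ?thesis using insert by (intro insert.IH) auto
    next
      case False
      let ?g = "f(x := \<zero>)"
      have sub: "{y. ?g y \<noteq> \<zero>} \<subseteq> {y. f y \<noteq> \<zero>}" by auto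
      have "finite {y. f y \<noteq> \<zero>}" "{y. f y \<noteq> \<zero>} \<subseteq> X"
        using insert.prems(1) by (auto simp: fin_supp_def)
      then have g: "?g \<in> fin_supp R X"
        using finite_subset[OF sub] sub fc by (auto simp: fin_supp_def)
      have "f = (\<lambda>y. ?g y \<oplus> f x \<otimes> single R x y)"
        using fc by (auto simp: single_def)
      moreover have "x \<in> X" using False insert.prems(1) by (auto simp: fin_supp_def)
      moreover have "P ?g" using insert.prems by (intro insert.IH g) auto
      ultimately show ?thesis using add[OF g fc[of x], of x] by simp
    qed
  qed
  then show ?thesis using assms(1) by (auto simp: fin_supp_def)
qed

text \<open>A functional on the free module is given by its values \<open>\<phi>\<close> on the
  basis, and \<open>lin \<phi>\<close> evaluates it. Identities between elements are tested against
  all such functionals, which turns computations with convolutions into substitutions in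
  \<open>\<phi>\<close>.\<close>

definition lin :: "('x \<Rightarrow> 'a) \<Rightarrow> ('x \<Rightarrow> 'a) \<Rightarrow> 'a" where
  "lin \<phi> f = (\<Oplus>x \<in> {x. f x \<noteq> \<zero>}. f x \<otimes> \<phi> x)"

lemma lin_eq_finsum:
  assumes "f \<in> fin_supp R X" "finite S" "{x. f x \<noteq> \<zero>} \<subseteq> S" "\<And>x. \<phi> x \<in> carrier R"
  shows "lin \<phi> f = (\<Oplus>x \<in> S. f x \<otimes> \<phi> x)"
  unfolding lin_def using assms fin_supp_closed[OF assms(1)]
  by (intro add.finprod_mono_neutral_cong_left) auto

lemma lin_closed:
  "f \<in> fin_supp R X \<Longrightarrow> (\<And>x. \<phi> x \<in> carrier R) \<Longrightarrow> lin \<phi> f \<in> carrier R"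
  unfolding lin_def using fin_supp_closed[of f R X] by (auto intro!: finsum_closed)

lemma lin_zero [simp]: "lin \<phi> (\<lambda>_. \<zero>) = \<zero>"
  by (simp add: lin_def)

lemma lin_add:
  assumes "f \<in> fin_supp R X" "g \<in> fin_supp R X" "\<And>x. \<phi> x \<in> carrier R"
  shows "lin \<phi> (\<lambda>x. f x \<oplus> g x) = lin \<phi> f \<oplus> lin \<phi> g"
proof -
  let ?S = "{x. f x \<noteq> \<zero>} \<union> {x. g x \<noteq> \<zero>}"
  note c = fin_supp_closed[OF assms(1)] fin_supp_closed[OF assms(2)] assms(3)
  have S: "finite ?S" using assms(1,2) by (auto simp: fin_supp_def)
  have "lin \<phi> (\<lambda>x. f x \<oplus> g x) = (\<Oplus>x \<in> ?S. (f x \<oplus> g x) \<otimes> \<phi> x)"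
    by (rule lin_eq_finsum[OF fin_supp_add[OF is_cring assms(1,2)] S _ assms(3)]) auto
  also have "\<dots> = (\<Oplus>x \<in> ?S. f x \<otimes> \<phi> x) \<oplus> (\<Oplus>x \<in> ?S. g x \<otimes> \<phi> x)"
    using c by (subst finsum_addf[symmetric]) (auto simp: l_distr intro!: finsum_cong')
  also have "\<dots> = lin \<phi> f \<oplus> lin \<phi> g"
    using lin_eq_finsum[OF assms(1) S _ assms(3)] lin_eq_finsum[OF assms(2) S _ assms(3)] by simp
  finally show ?thesis .
qed

lemma lin_smult:
  assumes "f \<in> fin_supp R X" "a \<in> carrier R" "\<And>x. \<phi> x \<in> carrier R"
  shows "lin \<phi> (\<lambda>x. a \<otimes> f x) = a \<otimes> lin \<phi> f"
proof -
  let ?S = "{x. f x \<noteq> \<zero>}"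
  note c = fin_supp_closed[OF assms(1)] assms(2,3)
  have S: "finite ?S" using assms(1) by (auto simp: fin_supp_def)
  have "lin \<phi> (\<lambda>x. a \<otimes> f x) = (\<Oplus>x \<in> ?S. (a \<otimes> f x) \<otimes> \<phi> x)"
    using assms(2) by (intro lin_eq_finsum[OF fin_supp_smult[OF is_cring assms(2,1)] S _ assms(3)]) auto
  also have "\<dots> = a \<otimes> lin \<phi> f" unfolding lin_def
    using c S by (subst finsum_rdistr) (auto simp: m_assoc intro!: finsum_cong')
  finally show ?thesis .
qed

lemma lin_single:
  assumes "\<And>x. \<phi> x \<in> carrier R"
  shows "lin \<phi> (single R x) = \<phi> x"
proof -
  have "lin \<phi> (single R x) = (\<Oplus>y \<in> {x}. single R x y \<otimes> \<phi> y)"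
    by (rule lin_eq_finsum[OF fin_supp_single[OF is_cring UNIV_I] _ _ assms]) (auto simp: single_def)
  then show ?thesis using assms by (simp add: single_def)
qed

lemma lin_fun_add:
  assumes "f \<in> fin_supp R X" "\<And>x. \<phi> x \<in> carrier R" "\<And>x. \<psi> x \<in> carrier R"
  shows "lin (\<lambda>x. \<phi> x \<oplus> \<psi> x) f = lin \<phi> f \<oplus> lin \<psi> f"
  unfolding lin_def using assms fin_supp_closed[OF assms(1)]
  by (subst finsum_addf[symmetric]) (auto simp: r_distr intro!: finsum_cong')

lemma lin_fun_zero: "f \<in> fin_supp R X \<Longrightarrow> lin (\<lambda>_. \<zero>) f = \<zero>"
  unfolding lin_def using fin_supp_closed[of f R X] by (auto intro!: add.finprod_one_eqI)

text \<open>Read as a functional, \<open>single R x\<close> is the coordinate at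
  \<open>x\<close>.\<close>

lemma lin_coeff:
  assumes "f \<in> fin_supp R X"
  shows "lin (single R x) f = f x"
  using assms
proof (induction rule: fin_supp_induct)
  case (add f a y)
  then show ?case
    using single_closed[OF is_cring, of x] fin_supp_closed[OF add(1)]
      lin_add[OF add(1) fin_supp_smult[OF is_cring add(2) fin_supp_single[OF is_cring add(3)]], of "single R x"]
      lin_smult[OF fin_supp_single[OF is_cring add(3)] add(2), of "single R x"] lin_single[of "single R x" y]
    by (auto simp: single_def)
qed (simp add: lin_def)

text \<open>Functionals separate elements because the coordinates are among them.\<close>

lemma fin_supp_eqI:
  assumes "f \<in> fin_supp R X" "g \<in> fin_supp R X"
    and "\<And>\<phi>. (\<And>x. \<phi> x \<in> carrier R) \<Longrightarrow> lin \<phi> f = lin \<phi> g"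
  shows "f = g"
proof
  fix x
  show "f x = g x"
    using assms(3)[of "single R x", OF single_closed[OF is_cring]]
    by (simp add: lin_coeff[OF assms(1)] lin_coeff[OF assms(2)])
qed

section \<open>The tensor algebra as a ring under convolution of words\<close>

definition conv :: "('x list \<Rightarrow> 'a) \<Rightarrow> ('x list \<Rightarrow> 'a) \<Rightarrow> 'x list \<Rightarrow> 'a" where
  "conv f g = (\<lambda>w. \<Oplus>i \<in> {0..length w}. f (take i w) \<otimes> g (drop i w))"

lemma tensor_algebra_simps:
  "carrier (tensor_algebra R X) = fin_supp R (lists X)"
  "mult (tensor_algebra R X) = conv"
  "one (tensor_algebra R X) = single R []"
  "zero (tensor_algebra R X) = (\<lambda>_. \<zero>)"
  "add (tensor_algebra R X) = (\<lambda>f g w. f w \<oplus> g w)"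
  "smult (tensor_algebra R X) = (\<lambda>a f w. a \<otimes> f w)"
  by (simp_all add: tensor_algebra_def conv_def fun_eq_iff)

lemma conv_zero:
  assumes "f \<in> fin_supp R X"
  shows "conv f (\<lambda>_. \<zero>) = (\<lambda>_. \<zero>)" "conv (\<lambda>_. \<zero>) f = (\<lambda>_. \<zero>)"
  using fin_supp_closed[OF assms] by (auto simp: conv_def intro!: add.finprod_one_eqI)

lemma conv_closed:
  assumes "f \<in> fin_supp R (lists X)" "g \<in> fin_supp R (lists X)"
  shows "conv f g \<in> fin_supp R (lists X)"
proof -
  note c = fin_supp_closed[OF assms(1)] fin_supp_closed[OF assms(2)]
  let ?S = "(\<lambda>(u, v). u @ v) ` ({u. f u \<noteq> \<zero>} \<times> {v. g v \<noteq> \<zero>})"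
  \<comment> \<open>A nonzero value at \<open>w\<close> forces some splitting of \<open>w\<close>
    into a word of the support of \<open>f\<close> and a word of the support of
    \<open>g\<close>.\<close>
  have "{w. conv f g w \<noteq> \<zero>} \<subseteq> ?S"
  proof
    fix w assume w: "w \<in> {w. conv f g w \<noteq> \<zero>}"
    have "\<exists>i \<in> {0..length w}. f (take i w) \<otimes> g (drop i w) \<noteq> \<zero>"
      using w by (auto simp: conv_def intro: add.finprod_one_eqI)
    then obtain i where "f (take i w) \<otimes> g (drop i w) \<noteq> \<zero>" by blast
    then have "f (take i w) \<noteq> \<zero>" "g (drop i w) \<noteq> \<zero>" using c by auto
    then show "w \<in> ?S" by (intro image_eqI[of _ _ "(take i w, drop i w)"]) auto
  qed
  moreover have "finite ?S" using assms by (auto simp: fin_supp_def)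
  moreover have "?S \<subseteq> lists X" using assms unfolding fin_supp_def by fastforce
  ultimately show ?thesis using c unfolding fin_supp_def conv_def
    by (auto intro!: finsum_closed dest: finite_subset)
qed

lemma conv_single:
  "conv (single R u) (single R v) = single R (u @ v)"
proof
  fix w
  show "conv (single R u) (single R v) w = single R (u @ v) w"
  proof (cases "w = u @ v")
    case True
    \<comment> \<open>Only the splitting of \<open>w\<close> after \<open>length u\<close> letters
      contributes.\<close>
    have "conv (single R u) (single R v) w = (\<Oplus>i \<in> {0..length w}. if length u = i then \<one> else \<zero>)"
      unfolding conv_def
    proof (rule finsum_cong')
      fix i assume "i \<in> {0..length w}"
      then have "length (take i w) = i" by simp
      then have "take i w = u \<longleftrightarrow> length u = i" using True by (metis append_eq_conv_conj)
      then show "single R u (take i w) \<otimes> single R v (drop i w) = (if length u = i then \<one> else \<zero>)"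
        using True by (auto simp: single_def)
    qed auto
    also have "\<dots> = \<one>" using True by (subst finsum_singleton) auto
    finally show ?thesis using True by (simp add: single_def)
  next
    case False
    then have "single R u (take i w) \<otimes> single R v (drop i w) = \<zero>" for i
      using append_take_drop_id[of i w] by (auto simp: single_def)
    then show ?thesis using False by (simp add: single_def conv_def)
  qed
qed

lemma conv_add_left:
  assumes "f \<in> fin_supp R X" "g \<in> fin_supp R X" "h \<in> fin_supp R X"
  shows "conv (\<lambda>w. f w \<oplus> g w) h = (\<lambda>w. conv f h w \<oplus> conv g h w)"
  using assms[THEN fin_supp_closed]
  unfolding conv_def by (intro ext, subst finsum_addf[symmetric]) (auto simp: l_distr intro!: finsum_cong')

lemma conv_add_right:
  assumes "f \<in> fin_supp R X" "g \<in> fin_supp R X" "h \<in> fin_supp R X"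
  shows "conv f (\<lambda>w. g w \<oplus> h w) = (\<lambda>w. conv f g w \<oplus> conv f h w)"
  using assms[THEN fin_supp_closed]
  unfolding conv_def by (intro ext, subst finsum_addf[symmetric]) (auto simp: r_distr intro!: finsum_cong')

lemma conv_smult_left:
  assumes "a \<in> carrier R" "f \<in> fin_supp R X" "h \<in> fin_supp R X"
  shows "conv (\<lambda>w. a \<otimes> f w) h = (\<lambda>w. a \<otimes> conv f h w)"
  using assms(1) assms(2,3)[THEN fin_supp_closed]
  unfolding conv_def by (intro ext, subst finsum_rdistr) (auto simp: m_assoc intro!: finsum_cong')

lemma conv_smult_right:
  assumes "a \<in> carrier R" "f \<in> fin_supp R X" "h \<in> fin_supp R X"
  shows "conv f (\<lambda>w. a \<otimes> h w) = (\<lambda>w. a \<otimes> conv f h w)"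
  using assms(1) assms(2,3)[THEN fin_supp_closed]
  unfolding conv_def by (intro ext, subst finsum_rdistr) (auto simp: m_lcomm intro!: finsum_cong')

text \<open>Both sides are bilinear in \<open>f\<close> and \<open>g\<close>, so two inductions
  reduce the claim to words, where the product is concatenation. Sums over splittings become nested
  functionals, and associativity of \<open>conv\<close> becomes associativity of
  \<open>@\<close>.\<close>

lemma lin_conv:
  assumes f: "f \<in> fin_supp R (lists X)" and g: "g \<in> fin_supp R (lists X)"
    and \<phi>: "\<And>w. \<phi> w \<in> carrier R"
  shows "lin \<phi> (conv f g) = lin (\<lambda>u. lin (\<lambda>v. \<phi> (u @ v)) g) f"
proof -
  note S = fin_supp_single[OF is_cring] and M = fin_supp_smult[OF is_cring]
  have 1: "lin \<phi> (conv (single R u) g) = lin (\<lambda>v. \<phi> (u @ v)) g" if u: "u \<in> lists X" for u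
    using g
  proof (induction rule: fin_supp_induct)
    case zero
    show ?case using conv_zero(1)[OF S[OF u]] by simp
  next
    case (add g a v)
    have "conv (single R u) (\<lambda>y. g y \<oplus> a \<otimes> single R v y)
      = (\<lambda>w. conv (single R u) g w \<oplus> a \<otimes> single R (u @ v) w)"
      using conv_add_right[OF S[OF u] add(1) M[OF add(2) S[OF add(3)]]]
        conv_smult_right[OF add(2) S[OF u] S[OF add(3)]] conv_single[of u v] by simp
    then show ?case using add u \<phi>
      lin_add[OF conv_closed[OF S[OF u] add(1)] M[OF add(2) S[of "u @ v"]], of \<phi>]
      lin_add[OF add(1) M[OF add(2) S[OF add(3)]], of "\<lambda>v. \<phi> (u @ v)"]
      lin_smult[OF S[of "u @ v" "lists X"] add(2), of \<phi>]
      lin_smult[OF S[of v "lists X"] add(2), of "\<lambda>v. \<phi> (u @ v)"]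
      by (simp add: lin_single)
  qed
  have \<psi>: "lin (\<lambda>v. \<phi> (u @ v)) g \<in> carrier R" for u by (rule lin_closed[OF g \<phi>])
  show ?thesis using f
  proof (induction rule: fin_supp_induct)
    case zero
    show ?case using conv_zero(2)[OF g] by simp
  next
    case (add f a u)
    have "conv (\<lambda>y. f y \<oplus> a \<otimes> single R u y) g
      = (\<lambda>w. conv f g w \<oplus> a \<otimes> conv (single R u) g w)"
      using conv_add_left[OF add(1) M[OF add(2) S[OF add(3)]] g]
        conv_smult_left[OF add(2) S[OF add(3)] g] by simp
    then show ?case using add \<phi> \<psi> 1[OF add(3)]
      lin_add[OF conv_closed[OF add(1) g] M[OF add(2) conv_closed[OF S[OF add(3)] g]], of \<phi>]
      lin_add[OF add(1) M[OF add(2) S[OF add(3)]], of "\<lambda>u. lin (\<lambda>v. \<phi> (u @ v)) g"]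
      lin_smult[OF conv_closed[OF S[OF add(3)] g] add(2), of \<phi>]
      lin_smult[OF S[of u "lists X"] add(2), of "\<lambda>u. lin (\<lambda>v. \<phi> (u @ v)) g"]
      by (simp add: lin_single)
  qed
qed

lemma conv_assoc:
  fixes f g h :: "'x list \<Rightarrow> 'a"
  assumes "f \<in> fin_supp R (lists X)" "g \<in> fin_supp R (lists X)" "h \<in> fin_supp R (lists X)"
  shows "conv (conv f g) h = conv f (conv g h)"
proof (rule fin_supp_eqI)
  show "conv (conv f g) h \<in> fin_supp R (lists X)" "conv f (conv g h) \<in> fin_supp R (lists X)"
    by (intro conv_closed assms)+
  fix \<phi> :: "'x list \<Rightarrow> 'a" assume \<phi>: "\<And>x. \<phi> x \<in> carrier R"
  have 1: "lin (\<lambda>v. \<phi> (u @ v)) h \<in> carrier R" for u by (rule lin_closed[OF assms(3) \<phi>])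
  show "lin \<phi> (conv (conv f g) h) = lin \<phi> (conv f (conv g h))"
    using \<phi> 1 lin_conv[OF conv_closed[OF assms(1,2)] assms(3), of \<phi>]
      lin_conv[OF assms(1,2), of "\<lambda>u. lin (\<lambda>v. \<phi> (u @ v)) h"]
      lin_conv[OF assms(1) conv_closed[OF assms(2,3)], of \<phi>]
      lin_conv[OF assms(2,3), of "\<lambda>v. \<phi> (u @ v)" for u]
    by simp
qed

lemma conv_one:
  assumes "f \<in> fin_supp R (lists X)"
  shows "conv (single R []) f = f" "conv f (single R []) = f"
proof -
  have 1: "single R [] \<in> fin_supp R (lists X)" by (rule fin_supp_single[OF is_cring]) simp
  show "conv (single R []) f = f"
    by (rule fin_supp_eqI[OF conv_closed[OF 1 assms] assms])
      (simp add: lin_conv[OF 1 assms] lin_single lin_closed[OF assms])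
  show "conv f (single R []) = f"
    by (rule fin_supp_eqI[OF conv_closed[OF assms 1] assms])
      (simp add: lin_conv[OF assms 1] lin_single)
qed

lemma module_tensor_algebra: "module R (tensor_algebra R X)"
proof (rule moduleI[OF is_cring])
  show "abelian_group (tensor_algebra R X)"
  proof (rule abelian_groupI)
    fix f assume f: "f \<in> carrier (tensor_algebra R X)"
    then show "\<exists>g \<in> carrier (tensor_algebra R X). g \<oplus>\<^bsub>tensor_algebra R X\<^esub> f = \<zero>\<^bsub>tensor_algebra R X\<^esub>"
      by (intro bexI[of _ "\<lambda>x. \<ominus> f x"])
        (auto simp: tensor_algebra_simps fin_supp_uminus fin_supp_closed l_neg)
  qed (simp_all add: tensor_algebra_simps fin_supp_add[OF is_cring] fin_supp_zero[OF is_cring]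
      fin_supp_closed a_ac fun_eq_iff)
qed (simp_all add: tensor_algebra_simps fin_supp_smult[OF is_cring] fin_supp_closed l_distr r_distr
    m_assoc fun_eq_iff)

lemma ring_tensor_algebra: "ring (tensor_algebra R X)"
proof -
  interpret F: module R "tensor_algebra R X" by (rule module_tensor_algebra)
  have 1: "single R [] \<in> fin_supp R (lists X)" by (rule fin_supp_single[OF is_cring]) simp
  show ?thesis
  proof (rule ringI[OF F.M.abelian_group_axioms])
    show "monoid (tensor_algebra R X)"
      by (rule monoidI) (auto simp: tensor_algebra_simps 1 conv_closed conv_assoc conv_one)
  qed (auto simp: tensor_algebra_simps conv_add_left conv_add_right)
qed

lemma deg1_zero: "deg1 R (\<lambda>_. \<zero>) = (\<lambda>_. \<zero>)"
  by (auto simp: deg1_def split: list.split)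

lemma deg2_single: "deg2 R (single R (x, y)) = single R [x, y]"
  by (auto simp: deg2_def single_def fun_eq_iff split: list.split)

lemma deg2_lincomb:
  assumes "p \<in> carrier R" "q \<in> carrier R"
  shows "deg2 R (\<lambda>z. p \<otimes> single R (x, y) z \<oplus> q \<otimes> single R (x', y') z) =
    (\<lambda>w. p \<otimes> single R [x, y] w \<oplus> q \<otimes> single R [x', y'] w)"
  unfolding deg2_single[symmetric] using assms by (auto simp: deg2_def fun_eq_iff split: list.split)

lemma fin_supp_minus:
  "f \<in> fin_supp R X \<Longrightarrow> g \<in> fin_supp R X \<Longrightarrow> (\<lambda>x. f x \<ominus> g x) \<in> fin_supp R X"
  unfolding a_minus_def by (intro fin_supp_add[OF is_cring] fin_supp_uminus)

lemma minus_zero_eq: "x \<in> carrier R \<Longrightarrow> y \<in> carrier R \<Longrightarrow> x \<ominus> y = \<zero> \<longleftrightarrow> x = y"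
  by (metis a_minus_def minus_equality minus_minus r_neg a_inv_closed)

text \<open>Meant for \<open>p\<close> a word, \<open>q\<close> and \<open>r\<close> the two words
  of its reduct, and \<open>q'\<close> and \<open>r'\<close> their normal forms: the defining
  relation plus the congruences of the two smaller words gives the congruence of \<open>p\<close>
  with its normal form.\<close>

lemma telescope:
  assumes "p \<in> carrier R" "k \<in> carrier R" "l \<in> carrier R"
    "q \<in> carrier R" "q' \<in> carrier R" "r \<in> carrier R" "r' \<in> carrier R"
  shows "p \<ominus> (k \<otimes> q \<oplus> l \<otimes> r) \<oplus> (k \<otimes> (q \<ominus> q') \<oplus> l \<otimes> (r \<ominus> r')) = p \<ominus> (k \<otimes> q' \<oplus> l \<otimes> r')"
proof -
  have "p \<ominus> (k \<otimes> q \<oplus> l \<otimes> r) \<oplus> (k \<otimes> (q \<ominus> q') \<oplus> l \<otimes> (r \<ominus> r')) =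
    p \<oplus> ((\<ominus> (k \<otimes> q') \<oplus> \<ominus> (l \<otimes> r')) \<oplus> ((\<ominus> (k \<otimes> q) \<oplus> k \<otimes> q) \<oplus> (\<ominus> (l \<otimes> r) \<oplus> l \<otimes> r)))"
    using assms by (simp add: minus_eq minus_add r_distr r_minus a_ac del: l_neg r_neg)
  then show ?thesis using assms by (simp add: l_neg minus_eq minus_add)
qed

lemma lin_uminus:
  assumes "f \<in> fin_supp R X" "\<And>x. \<phi> x \<in> carrier R"
  shows "lin \<phi> (\<lambda>x. \<ominus> f x) = \<ominus> lin \<phi> f"
proof -
  have "(\<lambda>x. \<ominus> f x) = (\<lambda>x. \<ominus> \<one> \<otimes> f x)" using fin_supp_closed[OF assms(1)] by (simp add: l_minus)
  then show ?thesis
    using lin_smult[OF assms(1) _ assms(2), of "\<ominus> \<one>"] lin_closed[OF assms] by (simp add: l_minus)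
qed

lemma lin_minus:
  assumes "f \<in> fin_supp R X" "g \<in> fin_supp R X" "\<And>x. \<phi> x \<in> carrier R"
  shows "lin \<phi> (\<lambda>x. f x \<ominus> g x) = lin \<phi> f \<ominus> lin \<phi> g"
  unfolding a_minus_def
  using lin_add[OF assms(1) fin_supp_uminus[OF assms(2)] assms(3)] lin_uminus[OF assms(2,3)] by simp

lemma lin_cong:
  assumes "f \<in> fin_supp R X" "\<And>x. x \<in> X \<Longrightarrow> \<phi> x = \<psi> x"  "\<And>x. \<psi> x \<in> carrier R"
  shows "lin \<phi> f = lin \<psi> f"
  unfolding lin_def using assms fin_supp_closed[OF assms(1)]
  by (intro finsum_cong') (auto simp: fin_supp_def)

lemma lin_fun_smult:
  assumes "f \<in> fin_supp R X" "a \<in> carrier R" "\<And>x. \<phi> x \<in> carrier R"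
  shows "lin (\<lambda>x. a \<otimes> \<phi> x) f = a \<otimes> lin \<phi> f"
  unfolding lin_def using assms fin_supp_closed[OF assms(1)]
  by (subst finsum_rdistr) (auto simp: fin_supp_def m_lcomm intro!: finsum_cong')

text \<open>\<open>lin_conv\<close> puts the left factor outermost. Exchanging the two functionals
  makes it innermost, which is what shows that a kernel is closed under multiplication from the
  right.\<close>

lemma lin_swap:
  assumes f: "f \<in> fin_supp R X" and g: "g \<in> fin_supp R Y" and \<phi>: "\<And>x y. \<phi> x y \<in> carrier R"
  shows "lin (\<lambda>x. lin (\<lambda>y. \<phi> x y) g) f = lin (\<lambda>y. lin (\<lambda>x. \<phi> x y) f) g"
  using g
proof (induction g rule: fin_supp_induct)
  case zero
  show ?case using lin_fun_zero[OF f] by simp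
next
  case (add g k t)
  have S: "single R t \<in> fin_supp R Y" using add(3) by (rule fin_supp_single[OF is_cring])
  have *: "lin \<psi> (\<lambda>y. g y \<oplus> k \<otimes> single R t y) = lin \<psi> g \<oplus> k \<otimes> \<psi> t"
    if "\<And>y. \<psi> y \<in> carrier R" for \<psi>
    using lin_add[OF add(1) fin_supp_smult[OF is_cring add(2) S] that] lin_smult[OF S add(2) that] that
    by (simp add: lin_single)
  have "lin (\<lambda>x. lin (\<phi> x) g \<oplus> k \<otimes> \<phi> x t) f = lin (\<lambda>x. lin (\<phi> x) g) f \<oplus> k \<otimes> lin (\<lambda>x. \<phi> x t) f"
    using lin_fun_add[OF f, of "\<lambda>x. lin (\<phi> x) g" "\<lambda>x. k \<otimes> \<phi> x t"]
      lin_fun_smult[OF f add(2), of "\<lambda>x. \<phi> x t"] lin_closed[OF add(1)] \<phi> add(2) by simp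
  then show ?case using add.IH by (simp add: * \<phi> lin_closed[OF f])
qed

end

subsection \<open>Quotients of the tensor algebra\<close>

text \<open>\<open>U_ideal\<close> evaluates \<open>T\<close> and \<open>br\<close> on basis tensors
  only, so closure is asked for only there.\<close>

locale word_quotient = cring R for R :: "('a, 'c) ring_scheme" (structure) +
  fixes X :: "'x set" and T :: "('x \<times> 'x \<Rightarrow> 'a) \<Rightarrow> 'x \<times> 'x \<Rightarrow> 'a"
    and br :: "('x \<times> 'x \<Rightarrow> 'a) \<Rightarrow> 'x \<Rightarrow> 'a"
  assumes T_closed: "x \<in> X \<Longrightarrow> y \<in> X \<Longrightarrow> T (single R (x, y)) \<in> fin_supp R (X \<times> X)"
    and br_closed: "x \<in> X \<Longrightarrow> y \<in> X \<Longrightarrow> br (single R (x, y)) \<in> fin_supp R X"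
begin

abbreviation A where "A \<equiv> tensor_algebra R X"
abbreviation I where "I \<equiv> U_ideal R X T br"
abbreviation U where "U \<equiv> U_alg R X T br"

sublocale A: ring A by (rule ring_tensor_algebra)
sublocale A: module R A by (rule module_tensor_algebra)

lemma A_uminus: "f \<in> carrier A \<Longrightarrow> \<ominus>\<^bsub>A\<^esub> f = (\<lambda>w. \<ominus> f w)"
  by (intro A.minus_equality) (auto simp: tensor_algebra_simps fin_supp_uminus fin_supp_closed l_neg)

lemma A_minus:
  "f \<in> carrier A \<Longrightarrow> g \<in> carrier A \<Longrightarrow> f \<ominus>\<^bsub>A\<^esub> g = (\<lambda>w. f w \<ominus> g w)"
  by (simp add: a_minus_def A_uminus) (simp add: tensor_algebra_simps)

lemma deg1_closed:
  assumes "f \<in> fin_supp R X"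
  shows "deg1 R f \<in> carrier A"
proof -
  have sub: "{w. deg1 R f w \<noteq> \<zero>} \<subseteq> (\<lambda>x. [x]) ` {x. f x \<noteq> \<zero>}"
    by (auto simp: deg1_def image_iff split: list.split_asm)
  have "finite {w. deg1 R f w \<noteq> \<zero>}"
    using assms by (intro finite_subset[OF sub] finite_imageI) (simp add: fin_supp_def)
  moreover have "{w. deg1 R f w \<noteq> \<zero>} \<subseteq> lists X"
    using sub assms by (force simp: fin_supp_def)
  ultimately show ?thesis using fin_supp_closed[OF assms]
    by (auto simp: tensor_algebra_simps fin_supp_def deg1_def split: list.splits)
qed

lemma deg2_closed:
  assumes "t \<in> fin_supp R (X \<times> X)"
  shows "deg2 R t \<in> carrier A"
proof -
  have sub: "{w. deg2 R t w \<noteq> \<zero>} \<subseteq> (\<lambda>(x, y). [x, y]) ` {z. t z \<noteq> \<zero>}"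
    by (auto simp: deg2_def image_iff split: list.split_asm)
  have "finite {w. deg2 R t w \<noteq> \<zero>}"
    using assms by (intro finite_subset[OF sub] finite_imageI) (simp add: fin_supp_def)
  moreover have "{w. deg2 R t w \<noteq> \<zero>} \<subseteq> lists X"
    using sub assms by (force simp: fin_supp_def)
  ultimately show ?thesis using fin_supp_closed[OF assms]
    by (auto simp: tensor_algebra_simps fin_supp_def deg2_def split: list.splits)
qed

definition gen :: "'x \<Rightarrow> 'x \<Rightarrow> 'x list \<Rightarrow> 'a" where
  "gen x y = deg2 R (single R (x, y)) \<ominus>\<^bsub>A\<^esub> deg2 R (T (single R (x, y)))
     \<ominus>\<^bsub>A\<^esub> deg1 R (br (single R (x, y)))"

lemma I_eq: "I = Idl\<^bsub>A\<^esub> {gen x y | x y. x \<in> X \<and> y \<in> X}"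
  by (simp add: U_ideal_def gen_def Let_def)

lemma gen_carrier: "x \<in> X \<Longrightarrow> y \<in> X \<Longrightarrow> gen x y \<in> carrier A"
  unfolding gen_def
  by (intro A.minus_closed deg1_closed deg2_closed T_closed br_closed fin_supp_single[OF is_cring]) auto

lemma gen_eq:
  assumes "x \<in> X" "y \<in> X"
  shows "gen x y w = deg2 R (single R (x, y)) w \<ominus> deg2 R (T (single R (x, y))) w
     \<ominus> deg1 R (br (single R (x, y))) w"
proof -
  have 1: "deg2 R (single R (x, y)) \<in> carrier A" "deg2 R (T (single R (x, y))) \<in> carrier A"
    "deg1 R (br (single R (x, y))) \<in> carrier A"
    using assms by (auto intro!: deg1_closed deg2_closed T_closed br_closed fin_supp_single[OF is_cring])
  show ?thesis
    unfolding gen_def A_minus[OF A.minus_closed[OF 1(1,2)] 1(3)] unfolding A_minus[OF 1(1,2)] ..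
qed

sublocale I: ideal I A
  unfolding I_eq by (rule A.genideal_ideal) (auto intro: gen_carrier)

lemma gen_in_I: "x \<in> X \<Longrightarrow> y \<in> X \<Longrightarrow> gen x y \<in> I"
  using A.genideal_self[of "{gen x y | x y. x \<in> X \<and> y \<in> X}"] gen_carrier unfolding I_eq by auto

text \<open>Scalars act through the ring: multiplying by \<open>a\<close> is multiplying from the
  left by \<open>a\<close> times the unit.\<close>

lemma I_smult:
  assumes "f \<in> I" "a \<in> carrier R"
  shows "(\<lambda>w. a \<otimes> f w) \<in> I"
proof -
  have f: "f \<in> fin_supp R (lists X)" using I.Icarr[OF assms(1)] by (simp add: tensor_algebra_simps)
  have 1: "single R [] \<in> fin_supp R (lists X)" by (rule fin_supp_single[OF is_cring]) simp
  have "conv (\<lambda>w. a \<otimes> single R [] w) f \<in> I"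
    using I.I_l_closed[OF assms(1), of "\<lambda>w. a \<otimes> single R [] w"] fin_supp_smult[OF is_cring assms(2) 1]
    by (simp add: tensor_algebra_simps)
  then show ?thesis using conv_smult_left[OF assms(2) 1 f] conv_one(1)[OF f] by simp
qed

lemma U_simps:
  "carrier U = carrier (A Quot I)" "mult U = mult (A Quot I)" "one U = one (A Quot I)"
  "zero U = zero (A Quot I)" "add U = add (A Quot I)"
  "smult U = (\<lambda>a C. \<Union>f \<in> C. I +>\<^bsub>A\<^esub> (a \<odot>\<^bsub>A\<^esub> f))"
  by (simp_all add: U_alg_def Let_def ring.defs module.defs)

lemma carrier_U: "carrier U = (\<lambda>f. I +>\<^bsub>A\<^esub> f) ` carrier A"
  unfolding U_simps by (auto simp: FactRing_simps)

sublocale Q: ring "A Quot I" by (rule I.quotient_is_ring)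

lemma coset_add:
  "f \<in> carrier A \<Longrightarrow> g \<in> carrier A \<Longrightarrow> (I +>\<^bsub>A\<^esub> f) \<oplus>\<^bsub>U\<^esub> (I +>\<^bsub>A\<^esub> g) = I +>\<^bsub>A\<^esub> (f \<oplus>\<^bsub>A\<^esub> g)"
  using ring_hom_add[OF I.rcos_ring_hom] by (simp add: U_simps)

lemma coset_mult:
  "f \<in> carrier A \<Longrightarrow> g \<in> carrier A \<Longrightarrow> (I +>\<^bsub>A\<^esub> f) \<otimes>\<^bsub>U\<^esub> (I +>\<^bsub>A\<^esub> g) = I +>\<^bsub>A\<^esub> (f \<otimes>\<^bsub>A\<^esub> g)"
  using ring_hom_mult[OF I.rcos_ring_hom] by (simp add: U_simps)

lemma coset_one: "\<one>\<^bsub>U\<^esub> = I +>\<^bsub>A\<^esub> single R []"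
  using ring_hom_one[OF I.rcos_ring_hom] by (simp add: U_simps tensor_algebra_simps)

lemma coset_zero: "\<zero>\<^bsub>U\<^esub> = I +>\<^bsub>A\<^esub> (\<lambda>_. \<zero>)"
  using ring_hom_zero[OF I.rcos_ring_hom A.ring_axioms Q.ring_axioms]
  by (simp add: U_simps tensor_algebra_simps)

lemma coset_eqI:
  assumes "f \<in> carrier A" "g \<in> carrier A" "(\<lambda>w. f w \<ominus> g w) \<in> I"
  shows "I +>\<^bsub>A\<^esub> f = I +>\<^bsub>A\<^esub> g"
  using A.quotient_eq_iff_same_a_r_cos[OF I.ideal_axioms assms(1,2)] assms(3) A_minus[OF assms(1,2)]
  by simp

lemma coset_eqD:
  assumes "f \<in> carrier A" "g \<in> carrier A" "I +>\<^bsub>A\<^esub> f = I +>\<^bsub>A\<^esub> g"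
  shows "(\<lambda>w. f w \<ominus> g w) \<in> I"
  using A.quotient_eq_iff_same_a_r_cos[OF I.ideal_axioms assms(1,2)] assms(3) A_minus[OF assms(1,2)]
  by simp

text \<open>The scalar multiplication of \<open>U_alg\<close> is a union over all representatives of
  a coset. By \<open>I_smult\<close> each of them contributes the same coset, and there is at least
  one, so the union collapses.\<close>

lemma coset_smult:
  assumes "f \<in> carrier A" "a \<in> carrier R"
  shows "a \<odot>\<^bsub>U\<^esub> (I +>\<^bsub>A\<^esub> f) = I +>\<^bsub>A\<^esub> (a \<odot>\<^bsub>A\<^esub> f)"
proof -
  have *: "I +>\<^bsub>A\<^esub> (a \<odot>\<^bsub>A\<^esub> g) = I +>\<^bsub>A\<^esub> (a \<odot>\<^bsub>A\<^esub> f)" if g: "g \<in> I +>\<^bsub>A\<^esub> f" for g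
  proof -
    have gA: "g \<in> carrier A" using g A.a_r_coset_subset_G[OF I.a_subset assms(1)] by blast
    have "I +>\<^bsub>A\<^esub> g = I +>\<^bsub>A\<^esub> f"
      using I.a_repr_independence'[OF g assms(1)] by simp
    from I_smult[OF coset_eqD[OF gA assms(1) this] assms(2)]
    have "(\<lambda>w. a \<otimes> g w \<ominus> a \<otimes> f w) \<in> I"
      using gA assms by (simp add: tensor_algebra_simps fin_supp_closed minus_eq r_distr r_minus)
    then show ?thesis
      using coset_eqI[of "a \<odot>\<^bsub>A\<^esub> g" "a \<odot>\<^bsub>A\<^esub> f"] gA assms A.smult_closed
      by (simp add: tensor_algebra_simps)
  qed
  have "f \<in> I +>\<^bsub>A\<^esub> f" by (rule I.a_rcos_self[OF assms(1)])
  then show ?thesis using * unfolding U_simps by blast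
qed

lemma module_U: "module R U"
proof (rule moduleI[OF is_cring])
  show "abelian_group U"
  proof (rule abelian_groupI)
    fix x assume "x \<in> carrier U"
    then show "\<exists>y \<in> carrier U. y \<oplus>\<^bsub>U\<^esub> x = \<zero>\<^bsub>U\<^esub>"
      using Q.l_neg Q.a_inv_closed unfolding U_simps by blast
  qed (auto simp: U_simps Q.a_ac)
qed (auto simp: carrier_U coset_smult coset_add A.smult_l_distr A.smult_r_distr A.smult_assoc1)

lemma U_gen_eq: "U_gen R X T br x = I +>\<^bsub>A\<^esub> single R [x]"
proof -
  have "deg1 R (single R x) = single R [x]"
    by (auto simp: deg1_def single_def split: list.splits)
  then show ?thesis by (simp add: U_gen_def)
qed

lemma single_A: "w \<in> lists X \<Longrightarrow> single R w \<in> carrier A"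
  by (simp add: tensor_algebra_simps fin_supp_single[OF is_cring])

lemma U_monomial_eq: "w \<in> lists X \<Longrightarrow> U_monomial R X T br w = I +>\<^bsub>A\<^esub> single R w"
proof (induction w)
  case Nil
  then show ?case by (simp add: U_monomial_def coset_one)
next
  case (Cons x w)
  then have "U_monomial R X T br (x # w) = (I +>\<^bsub>A\<^esub> single R [x]) \<otimes>\<^bsub>U\<^esub> (I +>\<^bsub>A\<^esub> single R w)"
    by (simp add: U_monomial_def U_gen_eq)
  also have "\<dots> = I +>\<^bsub>A\<^esub> single R (x # w)"
    using Cons single_A[of "[x]"] single_A[of w]
    by (subst coset_mult) (auto simp: tensor_algebra_simps conv_single)
  finally show ?case .
qed

text \<open>The coefficient function \<open>c\<close> is itself a representative of the combination
  it describes. Being a free basis thus means that every coset of \<open>I\<close> contains exactly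
  one function supported on \<open>J\<close>.\<close>

lemma finsum_monomials:
  assumes c: "c \<in> fin_supp R J" and J: "J \<subseteq> lists X"
  shows "(\<Oplus>\<^bsub>U\<^esub>w \<in> {w. c w \<noteq> \<zero>}. c w \<odot>\<^bsub>U\<^esub> U_monomial R X T br w) = I +>\<^bsub>A\<^esub> c"
proof -
  interpret U: module R U by (rule module_U)
  have mono: "c w \<odot>\<^bsub>U\<^esub> U_monomial R X T br w = I +>\<^bsub>A\<^esub> (c w \<odot>\<^bsub>A\<^esub> single R w)" if "w \<in> lists X" for w
    using that by (simp add: U_monomial_eq coset_smult single_A fin_supp_closed[OF c])
  have memb: "c w \<odot>\<^bsub>U\<^esub> U_monomial R X T br w \<in> carrier U" if "w \<in> lists X" for w
    unfolding mono[OF that] carrier_U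
    by (intro imageI A.smult_closed fin_supp_closed[OF c] single_A that)
  \<comment> \<open>The truncation of \<open>c\<close> to \<open>S\<close> makes an induction on
    finite sets of words possible; its membership in the algebra is carried along for
    \<open>coset_add\<close>.\<close>
  have *: "(\<lambda>w. if w \<in> S then c w else \<zero>) \<in> carrier A \<and>
    (\<Oplus>\<^bsub>U\<^esub>w \<in> S. c w \<odot>\<^bsub>U\<^esub> U_monomial R X T br w) = I +>\<^bsub>A\<^esub> (\<lambda>w. if w \<in> S then c w else \<zero>)"
    if "finite S" "S \<subseteq> lists X" for S
    using that
  proof (induction S rule: finite_induct)
    case empty
    have "(\<lambda>_. \<zero>) \<in> carrier A" by (simp add: tensor_algebra_simps fin_supp_zero[OF is_cring])
    then show ?case by (simp add: coset_zero)
  next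
    case (insert v S)
    let ?g = "\<lambda>w. if w \<in> S then c w else \<zero>"
    have IH: "?g \<in> carrier A" "(\<Oplus>\<^bsub>U\<^esub>w \<in> S. c w \<odot>\<^bsub>U\<^esub> U_monomial R X T br w) = I +>\<^bsub>A\<^esub> ?g"
      using insert by auto
    have v: "c v \<odot>\<^bsub>A\<^esub> single R v \<in> carrier A"
      using insert.prems by (intro A.smult_closed fin_supp_closed[OF c] single_A) auto
    have eq: "(c v \<odot>\<^bsub>A\<^esub> single R v) \<oplus>\<^bsub>A\<^esub> ?g = (\<lambda>w. if w \<in> insert v S then c w else \<zero>)"
      using insert.hyps fin_supp_closed[OF c] by (auto simp: tensor_algebra_simps single_def)
    have "(\<Oplus>\<^bsub>U\<^esub>w \<in> insert v S. c w \<odot>\<^bsub>U\<^esub> U_monomial R X T br w)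
      = c v \<odot>\<^bsub>U\<^esub> U_monomial R X T br v \<oplus>\<^bsub>U\<^esub> (\<Oplus>\<^bsub>U\<^esub>w \<in> S. c w \<odot>\<^bsub>U\<^esub> U_monomial R X T br w)"
      using insert.hyps insert.prems
      by (intro U.M.finsum_insert) (auto intro!: memb)
    also have "\<dots> = I +>\<^bsub>A\<^esub> ((c v \<odot>\<^bsub>A\<^esub> single R v) \<oplus>\<^bsub>A\<^esub> ?g)"
      using insert.prems mono[of v] IH v by (simp add: coset_add)
    finally show ?case using A.a_closed[OF v IH(1)] unfolding eq by simp
  qed
  have "finite {w. c w \<noteq> \<zero>}" "{w. c w \<noteq> \<zero>} \<subseteq> lists X" using c J by (auto simp: fin_supp_def)
  moreover have "(\<lambda>w. if w \<in> {w. c w \<noteq> \<zero>} then c w else \<zero>) = c" by auto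
  ultimately show ?thesis using *[of "{w. c w \<noteq> \<zero>}"] by simp
qed

end

subsection \<open>Normal forms of words\<close>

lemma exists_descent:
  fixes w :: "'x::linorder list"
  assumes "\<not> sorted w"
  shows "\<exists>u x y v. w = u @ x # y # v \<and> y < x"
  using assms
proof (induction w rule: induct_list012)
  case (3 x y w)
  show ?case
  proof (cases "y < x")
    case True
    then show ?thesis by (intro exI[of _ "[]"]) auto
  next
    case False
    then have "\<not> sorted (y # w)" using 3(3) by (metis not_less sorted2)
    then obtain u x' y' v where "y # w = u @ x' # y' # v" "y' < x'" using 3(2) by blast
    then show ?thesis by (intro exI[of _ "x # u"]) auto
  qed
qed auto

abbreviation word_less :: "('x::wellorder list \<times> 'x list) set" where
  "word_less \<equiv> lenlex {(x, y). x < y}"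

text \<open>The two words have equal length and first differ at \<open>s\<close> and
  \<open>x\<close>, so \<open>t\<close> and \<open>y\<close> are arbitrary. This is why
  \<open>partner\<close> bounds \<open>a x y\<close> and leaves \<open>b x y\<close> free.\<close>

lemma word_less_step:
  "s < x \<Longrightarrow> (u @ s # t # v, u @ x # y # v) \<in> word_less"
  by (simp add: lenlex_append2 irrefl_def Cons_lenlex_iff)

text \<open>
  In \<open>confluent\<close>, \<open>f\<close> plays the role of a coefficient of the normal form of \<open>u x y z v\<close> with \<open>u\<close> and
  \<open>v\<close> fixed; its reduction equations may be used for triples below \<open>(x, y, z)\<close> only, since they
  are the induction hypothesis when the equation for \<open>(x, y, z)\<close> itself is established.
\<close>

locale rewriting = cring R for R :: "('a, 'c) ring_scheme" (structure) +
  fixes X :: "'x::wellorder set" and c d :: "'x \<Rightarrow> 'x \<Rightarrow> 'a" and a b :: "'x \<Rightarrow> 'x \<Rightarrow> 'x"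
  assumes coeff_closed: "\<lbrakk>x \<in> X; y \<in> X; y < x\<rbrakk> \<Longrightarrow> c x y \<in> carrier R"
      "\<lbrakk>x \<in> X; y \<in> X; y < x\<rbrakk> \<Longrightarrow> d x y \<in> carrier R"
    and partner: "\<lbrakk>x \<in> X; y \<in> X; y < x\<rbrakk> \<Longrightarrow> a x y \<in> X" "\<lbrakk>x \<in> X; y \<in> X; y < x\<rbrakk> \<Longrightarrow> b x y \<in> X"
      "\<lbrakk>x \<in> X; y \<in> X; y < x\<rbrakk> \<Longrightarrow> a x y < x"
    and confluent: "\<And>(f :: 'x \<Rightarrow> 'x \<Rightarrow> 'x \<Rightarrow> 'a) x y z. \<lbrakk>x \<in> X; y \<in> X; z \<in> X; y < x; z < y;
      \<And>x y z. f x y z \<in> carrier R;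
      \<And>x' y' z'. \<lbrakk>x' \<in> X; y' \<in> X; z' \<in> X; (x', y', z') < (x, y, z); y' < x'\<rbrakk> \<Longrightarrow>
        f x' y' z' = c x' y' \<otimes> f y' x' z' \<oplus> d x' y' \<otimes> f (a x' y') (b x' y') z';
      \<And>x' y' z'. \<lbrakk>x' \<in> X; y' \<in> X; z' \<in> X; (x', y', z') < (x, y, z); z' < y'\<rbrakk> \<Longrightarrow>
        f x' y' z' = c y' z' \<otimes> f x' z' y' \<oplus> d y' z' \<otimes> f x' (a y' z') (b y' z')\<rbrakk> \<Longrightarrow>
      c x y \<otimes> f y x z \<oplus> d x y \<otimes> f (a x y) (b x y) z =
      c y z \<otimes> f x z y \<oplus> d y z \<otimes> f x (a y z) (b y z)"
begin

text \<open>The choice is arbitrary; \<open>nf_reduce\<close> shows that the normal form does not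
  depend on it.\<close>

definition descent :: "'x list \<Rightarrow> 'x list \<times> 'x \<times> 'x \<times> 'x list" where
  "descent w = (SOME (u, x, y, v). w = u @ x # y # v \<and> y < x)"

lemma descentD:
  assumes "\<not> sorted w" "descent w = (u, x, y, v)"
  shows "w = u @ x # y # v \<and> y < x"
  using someI_ex[of "\<lambda>(u, x, y, v). w = u @ x # y # v \<and> y < x"] exists_descent[OF assms(1)] assms(2)
  unfolding descent_def by auto

lemma descent_less:
  assumes "\<not> sorted w" "(u, x, y, v) = descent w" "\<forall>x \<in> set w. x \<in> X"
  shows "(u @ y # x # v, w) \<in> word_less" "(u @ a x y # b x y # v, w) \<in> word_less"
proof -
  have w: "w = u @ x # y # v" "y < x" using descentD[OF assms(1) assms(2)[symmetric]] by simp_all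
  then have "x \<in> X" "y \<in> X" using assms(3) by auto
  then show "(u @ y # x # v, w) \<in> word_less" "(u @ a x y # b x y # v, w) \<in> word_less"
    using w partner(3)[of x y] by (auto intro: word_less_step)
qed

text \<open>\<open>nf w s\<close> is the coefficient of \<open>s\<close> in the normal form of
  \<open>w\<close>. A word with letters outside \<open>X\<close> is left as it is, because
  \<open>partner\<close> guarantees descent in the word order for letters of \<open>X\<close>
  only.\<close>

function nf :: "'x list \<Rightarrow> 'x list \<Rightarrow> 'a" where
  "nf w = (if w \<in> lists X \<and> \<not> sorted w
    then (case descent w of (u, x, y, v) \<Rightarrow>
      (\<lambda>s. c x y \<otimes> nf (u @ y # x # v) s \<oplus> d x y \<otimes> nf (u @ a x y # b x y # v) s))
    else single R w)"
  by auto
termination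
  by (relation word_less) (auto intro: descent_less intro!: wf_lenlex wf)

declare nf.simps [simp del]

text \<open>The value that \<open>nf\<close> would take if the descent following \<open>u\<close>
  were the selected one.\<close>

definition red :: "'x list \<Rightarrow> 'x \<Rightarrow> 'x \<Rightarrow> 'x list \<Rightarrow> 'x list \<Rightarrow> 'a" where
  "red u x y v s = c x y \<otimes> nf (u @ y # x # v) s \<oplus> d x y \<otimes> nf (u @ a x y # b x y # v) s"

lemma nf_irreducible: "w \<notin> lists X \<or> sorted w \<Longrightarrow> nf w = single R w"
  by (subst nf.simps) auto

lemma nf_descent:
  assumes "w \<in> lists X" "\<not> sorted w"
  obtains u x y v where "w = u @ x # y # v" "y < x" "nf w = red u x y v"
proof -
  obtain u x y v where D: "descent w = (u, x, y, v)" by (cases "descent w") auto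
  then have "nf w = red u x y v" using assms by (subst nf.simps) (auto simp: red_def fun_eq_iff)
  then show thesis using that descentD[OF assms(2) D] by blast
qed

lemma word_induct [case_names less]:
  "(\<And>w. (\<And>w'. (w', w) \<in> word_less \<Longrightarrow> P w') \<Longrightarrow> P w) \<Longrightarrow> P w"
  using wf_induct_rule[OF wf_lenlex[OF wf], of P w] by blast

lemma nf_closed: "nf w s \<in> carrier R"
proof (induction w rule: word_induct)
  case (less w)
  show ?case
  proof (cases "w \<notin> lists X \<or> sorted w")
    case True
    then show ?thesis by (simp add: nf_irreducible single_closed[OF is_cring])
  next
    case False
    then obtain u x y v where w: "w = u @ x # y # v" "y < x" "nf w = red u x y v"
      using nf_descent by blast
    have "nf (u @ y # x # v) s \<in> carrier R" "nf (u @ a x y # b x y # v) s \<in> carrier R"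
      using False w by (auto intro!: less word_less_step partner)
    then show ?thesis using False w coeff_closed[of x y] by (auto simp: red_def)
  qed
qed

text \<open>The core of the diamond lemma: any descent may be reduced first. By induction along
  \<open>word_less\<close>, the reduction at the given descent is compared with the one at the
  selected descent; all words that occur on the way are smaller.\<close>

lemma nf_reduce:
  assumes "u @ x # y # v \<in> lists X" "y < x"
  shows "nf (u @ x # y # v) s = red u x y v s"
proof -
  have "\<forall>u x y v. w = u @ x # y # v \<longrightarrow> y < x \<longrightarrow> w \<in> lists X \<longrightarrow> nf w s = red u x y v s" for w
  proof (induction w rule: word_induct)
    case (less w)
    have IH: "nf (u @ x # y # v) s = red u x y v s"
      if "(u @ x # y # v, w) \<in> word_less" "y < x" "u @ x # y # v \<in> lists X" for u x y v
      using less that by blast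
    \<comment> \<open>Two descents of the same word, the second starting \<open>length t\<close>
      letters to the right of the first.\<close>
    have agree: "red u x y v s = red (u @ t) x' y' v' s"
      if w: "w = u @ x # y # v" "x # y # v = t @ x' # y' # v'" "y < x" "y' < x'" "w \<in> lists X"
      for u x y v t x' y' v'
    proof -
      have "x # y # v \<in> lists X" using w(1,5) by simp
      moreover from this have "t @ x' # y' # v' \<in> lists X" unfolding w(2) .
      ultimately have X: "x \<in> X" "y \<in> X" "x' \<in> X" "y' \<in> X" by simp_all
      \<comment> \<open>The descents coincide, share the letter \<open>y\<close>, or are
        disjoint.\<close>
      consider "t = []" | "t = [x]" "x' = y" "v = y' # v'"
        | m where "t = x # y # m" "v = m @ x' # y' # v'"
        using w(2) by (cases t; cases "tl t") auto
      then show ?thesis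
      proof cases
        case 1
        then show ?thesis using w by auto
      next
        case 2
        have z: "y' < y" using 2 w by simp
        let ?f = "\<lambda>x y z. nf (u @ x # y # z # v') s"
        \<comment> \<open>Lowering the triple in a fixed context lowers the word, so the induction
          hypothesis supplies the reduction equations that \<open>confluent\<close> may
          assume.\<close>
        have less3: "(u @ p # q # r # v', w) \<in> word_less" if "(p, q, r) < (x, y, y')" for p q r
          using that w 2 by (auto simp: lenlex_append2 irrefl_def Cons_lenlex_iff less_prod_def')
        have L: "set u \<subseteq> X" "set v' \<subseteq> X" using w 2 by auto
        have "c x y \<otimes> ?f y x y' \<oplus> d x y \<otimes> ?f (a x y) (b x y) y' =
          c y y' \<otimes> ?f x y' y \<oplus> d y y' \<otimes> ?f x (a y y') (b y y')"
        proof (rule confluent)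
          fix p q r assume A: "p \<in> X" "q \<in> X" "r \<in> X" "(p, q, r) < (x, y, y')"
          show "q < p \<Longrightarrow> ?f p q r = c p q \<otimes> ?f q p r \<oplus> d p q \<otimes> ?f (a p q) (b p q) r"
            using IH[of u p q "r # v'"] less3[OF A(4)] A L by (auto simp: red_def)
          show "r < q \<Longrightarrow> ?f p q r = c q r \<otimes> ?f p r q \<oplus> d q r \<otimes> ?f p (a q r) (b q r)"
            using IH[of "u @ [p]" q r "v'"] less3[OF A(4)] A L by (auto simp: red_def)
        qed (use X z w(3) nf_closed in auto)
        then show ?thesis using 2 by (simp add: red_def)
      next
        case 3
        have L: "set u \<subseteq> X" "set m \<subseteq> X" "set v' \<subseteq> X" using w 3 by auto
        let ?N = "\<lambda>p q p' q'. nf (u @ p # q # m @ p' # q' # v') s"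
        \<comment> \<open>Reducing one of two disjoint descents leaves the other in place in a
          smaller word. Reducing that one as well gives, in either order, the same sum of four
          terms.\<close>
        have 1: "?N p q x' y' = c x' y' \<otimes> ?N p q y' x' \<oplus> d x' y' \<otimes> ?N p q (a x' y') (b x' y')"
          if "p < x" "p \<in> X" "q \<in> X" for p q
          using IH[of "u @ p # q # m" x' y' v'] that w 3 X L
          by (auto simp: red_def intro!: word_less_step)
        have 2: "?N x y p q = c x y \<otimes> ?N y x p q \<oplus> d x y \<otimes> ?N (a x y) (b x y) p q"
          if "p < x'" "p \<in> X" "q \<in> X" for p q
          using IH[of u x y "m @ p # q # v'"] that w 3 X L
            word_less_step[of p x' "u @ x # y # m" q v' y']
          by (auto simp: red_def)
        have N: "?N p q p' q' \<in> carrier R" for p q p' q' by (rule nf_closed)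
        note C = coeff_closed[OF X(1,2) w(3)] coeff_closed[OF X(3,4) w(4)]
        note P = partner[OF X(1,2) w(3)] partner[OF X(3,4) w(4)]
        have "red u x y v s = c x y \<otimes> ?N y x x' y' \<oplus> d x y \<otimes> ?N (a x y) (b x y) x' y'"
          using 3 by (simp add: red_def)
        also have "\<dots> = c x' y' \<otimes> ?N x y y' x' \<oplus> d x' y' \<otimes> ?N x y (a x' y') (b x' y')"
          unfolding 1[OF w(3) X(2,1)] 1[OF P(3,1,2)] 2[OF w(4) X(4,3)] 2[OF P(6,4,5)]
          using N C by (simp add: r_distr m_ac a_ac)
        also have "\<dots> = red (u @ t) x' y' v' s"
          using 3 by (simp add: red_def)
        finally show ?thesis .
      qed
    qed
    show ?case
    proof (intro allI impI)
      fix u x y v assume w: "w = u @ x # y # v" "y < x" "w \<in> lists X"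
      have "\<not> sorted w" using w(1,2) by (auto simp: sorted_append)
      from nf_descent[OF w(3) this] obtain u' x' y' v' where
        w': "w = u' @ x' # y' # v'" "y' < x'" "nf w = red u' x' y' v'" .
      from w(1) w'(1) have "u @ x # y # v = u' @ x' # y' # v'" by simp
      \<comment> \<open>Of two prefixes of the same word one extends the other; the roles in
        \<open>agree\<close> are exchanged accordingly.\<close>
      then consider t where "u' = u @ t" "x # y # v = t @ x' # y' # v'"
        | t where "u = u' @ t" "x' # y' # v' = t @ x # y # v"
        by (auto simp: append_eq_append_conv2)
      then have "red u x y v s = red u' x' y' v' s"
      proof cases
        case 1
        show ?thesis unfolding 1(1) by (rule agree[OF w(1) 1(2) w(2) w'(2) w(3)])
      next
        case 2
        show ?thesis unfolding 2(1) by (rule agree[OF w'(1) 2(2) w'(2) w(2,3), symmetric])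
      qed
      then show "nf w s = red u x y v s" using w'(3) by simp
    qed
  qed
  then show ?thesis using assms by blast
qed

lemma nf_fin_supp:
  assumes "w \<in> lists X"
  shows "nf w \<in> fin_supp R {s \<in> lists X. sorted s}"
  using assms
proof (induction w rule: word_induct)
  case (less w)
  show ?case
  proof (cases "sorted w")
    case True
    then show ?thesis using less by (simp add: nf_irreducible fin_supp_single[OF is_cring])
  next
    case False
    then obtain u x y v where w: "w = u @ x # y # v" "y < x" "nf w = red u x y v"
      using nf_descent less by blast
    have X: "x \<in> X" "y \<in> X" using less(2) w by auto
    have "nf (u @ y # x # v) \<in> fin_supp R {s \<in> lists X. sorted s}"
      "nf (u @ a x y # b x y # v) \<in> fin_supp R {s \<in> lists X. sorted s}"
      using less(2) w partner[OF X w(2)] by (auto intro!: less(1) word_less_step)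
    then show ?thesis unfolding w(3) red_def
      by (intro fin_supp_add[OF is_cring] fin_supp_smult[OF is_cring] coeff_closed X w(2))
  qed
qed

end

subsection \<open>The basis of sorted words\<close>

text \<open>\<open>T_diag\<close> and \<open>T_less\<close> express that pairs not in decreasing
  order contribute no new relations: they give zero or a multiple of a rewriting rule. Hence the
  ideal is generated by the rules of \<open>T_greater\<close>.\<close>

locale quadratic_algebra = word_quotient R X T br + rewriting R X c d a b
  for R :: "('a, 'c) ring_scheme" (structure) and X :: "'x::wellorder set" and T br c d a b +
  assumes T_greater: "\<lbrakk>x \<in> X; y \<in> X; y < x\<rbrakk> \<Longrightarrow> T (single R (x, y)) =
      (\<lambda>z. c x y \<otimes> single R (y, x) z \<oplus> d x y \<otimes> single R (a x y, b x y) z)"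
    and T_diag: "x \<in> X \<Longrightarrow> T (single R (x, x)) = single R (x, x)"
    and T_less: "\<lbrakk>x \<in> X; y \<in> X; y < x\<rbrakk> \<Longrightarrow> \<exists>k \<in> carrier R. \<forall>z.
      single R (y, x) z \<ominus> T (single R (y, x)) z = k \<otimes> (single R (x, y) z \<ominus> T (single R (x, y)) z)"
    and br_zero: "\<lbrakk>x \<in> X; y \<in> X\<rbrakk> \<Longrightarrow> br (single R (x, y)) = (\<lambda>_. \<zero>)"
begin

definition rel :: "'x list \<Rightarrow> 'x \<Rightarrow> 'x \<Rightarrow> 'x list \<Rightarrow> 'x list \<Rightarrow> 'a" where
  "rel u x y v = (\<lambda>w. single R (u @ x # y # v) w \<ominus>
     (c x y \<otimes> single R (u @ y # x # v) w \<oplus> d x y \<otimes> single R (u @ a x y # b x y # v) w))"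

lemma rel_parts:
  assumes "u @ x # y # v \<in> lists X" "y < x"
  shows "single R (u @ x # y # v) \<in> fin_supp R (lists X)"
    "(\<lambda>w. c x y \<otimes> single R (u @ y # x # v) w) \<in> fin_supp R (lists X)"
    "(\<lambda>w. d x y \<otimes> single R (u @ a x y # b x y # v) w) \<in> fin_supp R (lists X)"
  using assms by (auto intro!: fin_supp_smult[OF is_cring] fin_supp_single[OF is_cring] coeff_closed partner)

lemma rel_closed:
  "u @ x # y # v \<in> lists X \<Longrightarrow> y < x \<Longrightarrow> rel u x y v \<in> fin_supp R (lists X)"
  unfolding rel_def by (intro fin_supp_minus fin_supp_add[OF is_cring] rel_parts)

lemma lin_rel:
  assumes "u @ x # y # v \<in> lists X" "y < x" "\<And>w. \<phi> w \<in> carrier R"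
  shows "lin \<phi> (rel u x y v) = \<phi> (u @ x # y # v) \<ominus>
    (c x y \<otimes> \<phi> (u @ y # x # v) \<oplus> d x y \<otimes> \<phi> (u @ a x y # b x y # v))"
proof -
  have X: "x \<in> X" "y \<in> X" using assms(1) by auto
  note C = coeff_closed[OF X assms(2)]
  note S = fin_supp_single[OF is_cring UNIV_I]
  show ?thesis unfolding rel_def
    by (simp add: lin_minus[OF rel_parts(1)[OF assms(1,2)] fin_supp_add[OF is_cring rel_parts(2,3)[OF assms(1,2)]]]
        lin_add[OF rel_parts(2,3)[OF assms(1,2)]] lin_smult[OF S] lin_single C assms(3))
qed

lemma gen_greater:
  assumes "x \<in> X" "y \<in> X" "y < x"
  shows "gen x y = rel [] x y []"
  using coeff_closed[OF assms]
  by (intro ext) (simp add: single_closed[OF is_cring] gen_eq[OF assms(1,2)] T_greater[OF assms] br_zero[OF assms(1,2)]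
      rel_def deg1_zero deg2_single deg2_lincomb minus_eq)

lemma gen_diag: "x \<in> X \<Longrightarrow> gen x x = (\<lambda>_. \<zero>)"
  by (intro ext) (simp add: single_closed[OF is_cring] gen_eq T_diag br_zero deg1_zero deg2_single r_neg minus_eq)

lemma gen_less:
  assumes "x \<in> X" "y \<in> X" "y < x"
  shows "\<exists>k \<in> carrier R. gen y x = (\<lambda>w. k \<otimes> rel [] x y [] w)"
proof -
  obtain k where k: "k \<in> carrier R" "\<And>z. single R (y, x) z \<ominus> T (single R (y, x)) z =
      k \<otimes> (single R (x, y) z \<ominus> T (single R (x, y)) z)"
    using T_less[OF assms] by blast
  have c: "T (single R z) t \<in> carrier R" "single R z t \<in> carrier R" if "z \<in> X \<times> X" for z t
    using that T_closed by (auto intro: fin_supp_closed single_closed[OF is_cring])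
  have g: "gen p q w = deg2 R (\<lambda>z. single R (p, q) z \<ominus> T (single R (p, q)) z) w"
    if "p \<in> X" "q \<in> X" for p q w
    using c[of "(p, q)"] that
    by (simp add: gen_eq br_zero deg1_zero) (simp add: deg2_def minus_eq split: list.split)
  have "gen y x w = k \<otimes> gen x y w" for w
    unfolding g[OF assms(2,1)] g[OF assms(1,2)] k(2)
    using k(1) by (simp add: deg2_def split: list.split)
  then show ?thesis using k(1) gen_greater[OF assms] by auto
qed

text \<open>Quantifying over the contexts \<open>u\<close> and \<open>v\<close> makes this kernel of \<open>nf\<close> a two-sided ideal.\<close>

definition annihilated :: "('x list \<Rightarrow> 'a) set" where
  "annihilated = {f \<in> carrier A. \<forall>u \<in> lists X. \<forall>v \<in> lists X. \<forall>s. lin (\<lambda>w. nf (u @ w @ v) s) f = \<zero>}"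

text \<open>In the context of \<open>u\<close> and \<open>v\<close> this is the reduction equation
  \<open>nf_reduce\<close> for the descent \<open>x y\<close>.\<close>

lemma rel_annihilated:
  assumes "x \<in> X" "y \<in> X" "y < x"
  shows "rel [] x y [] \<in> annihilated"
proof -
  have "lin (\<lambda>w. nf (u @ w @ v) s) (rel [] x y []) = \<zero>" if "u \<in> lists X" "v \<in> lists X" for u v s
    using lin_rel[of "[]" x y "[]" "\<lambda>w. nf (u @ w @ v) s"] assms that nf_closed
      nf_reduce[of u x y v s] coeff_closed[OF assms]
    by (simp add: red_def r_neg minus_eq)
  then show ?thesis using assms rel_closed[of "[]" x y "[]"]
    by (simp add: annihilated_def tensor_algebra_simps)
qed

lemma ideal_annihilated: "ideal annihilated A"
proof (rule idealI[OF A.ring_axioms])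
  note N = nf_closed
  show "subgroup annihilated (add_monoid A)"
  proof (rule A.add.subgroupI)
    show "annihilated \<subseteq> carrier A" by (auto simp: annihilated_def)
    have "(\<lambda>_. \<zero>) \<in> annihilated"
      by (simp add: annihilated_def tensor_algebra_simps fin_supp_zero[OF is_cring])
    then show "annihilated \<noteq> {}" by blast
  next
    fix f g assume fg: "f \<in> annihilated" "g \<in> annihilated"
    then have "lin (\<lambda>w. nf (u @ w @ v) s) (\<lambda>w. f w \<oplus> g w) = \<zero>" if "u \<in> lists X" "v \<in> lists X" for u v s
      using that by (subst lin_add[of _ "lists X"]) (auto simp: annihilated_def tensor_algebra_simps N)
    then show "f \<oplus>\<^bsub>A\<^esub> g \<in> annihilated"
      using fg A.a_closed by (auto simp: annihilated_def tensor_algebra_simps)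
  next
    fix f assume f: "f \<in> annihilated"
    then have "lin (\<lambda>w. nf (u @ w @ v) s) (\<lambda>w. \<ominus> f w) = \<zero>" if "u \<in> lists X" "v \<in> lists X" for u v s
      using that by (subst lin_uminus[of _ "lists X"]) (auto simp: annihilated_def tensor_algebra_simps N)
    then show "\<ominus>\<^bsub>A\<^esub> f \<in> annihilated"
      using f A.a_inv_closed[of f] by (auto simp: annihilated_def A_uminus)
  qed
next
  note N = nf_closed
  fix f g assume fg: "f \<in> annihilated" "g \<in> carrier A"
  then have *: "f \<in> fin_supp R (lists X)" "g \<in> fin_supp R (lists X)"
    by (simp_all add: annihilated_def tensor_algebra_simps)
  have f: "lin (\<lambda>w. nf (u @ w @ v) s) f = \<zero>" if "u \<in> lists X" "v \<in> lists X" for u v s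
    using fg(1) that by (simp add: annihilated_def)
  \<comment> \<open>A word of the left factor \<open>g\<close> is absorbed into the context
    \<open>u\<close>.\<close>
  have "lin (\<lambda>w. nf (u @ w @ v) s) (conv g f) = \<zero>" if "u \<in> lists X" "v \<in> lists X" for u v s
    using that f[of "u @ p" v s for p] lin_fun_zero[OF *(2)]
      lin_cong[OF *(2), of "\<lambda>p. lin (\<lambda>w. nf (u @ p @ w @ v) s) f" "\<lambda>_. \<zero>"]
    by (simp add: lin_conv[OF *(2,1) nf_closed])
  then show "g \<otimes>\<^bsub>A\<^esub> f \<in> annihilated"
    using conv_closed[OF *(2,1)] by (simp add: annihilated_def tensor_algebra_simps)
  have "lin (\<lambda>w. nf (u @ w @ v) s) (conv f g) = \<zero>" if "u \<in> lists X" "v \<in> lists X" for u v s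
  proof -
    have "lin (\<lambda>w. nf (u @ w @ v) s) (conv f g) = lin (\<lambda>p. lin (\<lambda>t. nf (u @ (p @ t) @ v) s) g) f"
      by (rule lin_conv[OF *]) (rule N)
    \<comment> \<open>With \<open>f\<close> innermost, a word \<open>t\<close> of the right factor
      is absorbed into the context \<open>v\<close>.\<close>
    also have "\<dots> = lin (\<lambda>t. lin (\<lambda>p. nf (u @ p @ t @ v) s) f) g"
      by (simp add: lin_swap[OF *] N)
    also have "\<dots> = lin (\<lambda>_. \<zero>) g"
      using that f[of u "t @ v" s for t] by (intro lin_cong[OF *(2)]) auto
    also have "\<dots> = \<zero>" by (rule lin_fun_zero[OF *(2)])
    finally show ?thesis .
  qed
  then show "f \<otimes>\<^bsub>A\<^esub> g \<in> annihilated"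
    using conv_closed[OF *(1,2)] by (simp add: annihilated_def tensor_algebra_simps)
qed

text \<open>The independence half of the basis theorem: the linear extension of \<open>nf\<close>
  descends to the quotient.\<close>

lemma I_annihilated: "I \<subseteq> annihilated"
proof -
  have "gen x y \<in> annihilated" if X: "x \<in> X" "y \<in> X" for x y
  proof -
    consider "y < x" | "x = y" | "x < y" by fastforce
    then show ?thesis
    proof cases
      case 1
      then show ?thesis using rel_annihilated gen_greater X by simp
    next
      case 2
      then show ?thesis using gen_diag X
        by (simp add: annihilated_def tensor_algebra_simps fin_supp_zero[OF is_cring])
    next
      case 3
      then obtain k where k: "k \<in> carrier R" "gen x y = (\<lambda>w. k \<otimes> rel [] y x [] w)"
        using gen_less[OF X(2,1)] by blast
      have r: "rel [] y x [] \<in> annihilated" by (rule rel_annihilated[OF X(2,1) 3])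
      then have rc: "rel [] y x [] \<in> fin_supp R (lists X)"
        by (simp add: annihilated_def tensor_algebra_simps)
      show ?thesis unfolding k(2)
        using r k(1) fin_supp_smult[OF is_cring k(1) rc]
        by (auto simp: annihilated_def tensor_algebra_simps lin_smult[OF rc k(1) nf_closed])
    qed
  qed
  then show ?thesis unfolding I_eq
    by (intro A.genideal_minimal ideal_annihilated) auto
qed

text \<open>A rule in context is the product of the word \<open>u\<close>, the bare rule and the
  word \<open>v\<close>; the equality is tested on functionals.\<close>

lemma rel_in_I:
  assumes "u @ x # y # v \<in> lists X" "y < x"
  shows "rel u x y v \<in> I"
proof -
  have X: "x \<in> X" "y \<in> X" "u \<in> lists X" "v \<in> lists X" using assms(1) by auto
  have S: "single R u \<in> fin_supp R (lists X)" "single R v \<in> fin_supp R (lists X)"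
    using X by (auto intro: fin_supp_single[OF is_cring])
  have r: "rel [] x y [] \<in> fin_supp R (lists X)" using X assms(2) by (intro rel_closed) auto
  have "rel [] x y [] \<in> I" using gen_in_I[OF X(1,2)] gen_greater[OF X(1,2) assms(2)] by simp
  then have "conv (conv (single R u) (rel [] x y [])) (single R v) \<in> I"
    using S I.I_l_closed I.I_r_closed by (simp add: tensor_algebra_simps)
  also have "conv (conv (single R u) (rel [] x y [])) (single R v) = rel u x y v"
  proof (rule fin_supp_eqI)
    show "conv (conv (single R u) (rel [] x y [])) (single R v) \<in> fin_supp R (lists X)"
      by (intro conv_closed S r)
    show "rel u x y v \<in> fin_supp R (lists X)" by (rule rel_closed[OF assms])
    fix \<phi> :: "'x list \<Rightarrow> 'a" assume \<phi>: "\<And>w. \<phi> w \<in> carrier R"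
    show "lin \<phi> (conv (conv (single R u) (rel [] x y [])) (single R v)) = lin \<phi> (rel u x y v)"
      using X assms(2) coeff_closed[OF X(1,2) assms(2)]
      by (simp add: lin_conv[OF conv_closed[OF S(1) r] S(2)] lin_conv[OF S(1) r] lin_single \<phi>
          lin_closed[OF r] lin_rel[OF _ assms(2)] lin_rel[OF assms])
  qed
  finally show ?thesis .
qed

lemma I_add: "f \<in> I \<Longrightarrow> g \<in> I \<Longrightarrow> (\<lambda>w. f w \<oplus> g w) \<in> I"
  using I.a_closed[of f g] by (simp add: tensor_algebra_simps)

lemma I_zero: "(\<lambda>_. \<zero>) \<in> I"
  using I.zero_closed by (simp add: tensor_algebra_simps)

text \<open>The spanning half: a word is congruent to its normal form, by induction along the
  reduction that defines \<open>nf\<close>.\<close>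

lemma nf_congruent:
  assumes "w \<in> lists X"
  shows "(\<lambda>s. single R w s \<ominus> nf w s) \<in> I"
  using assms
proof (induction w rule: word_induct)
  case (less w)
  show ?case
  proof (cases "sorted w")
    case True
    then show ?thesis
      using I_zero single_closed[OF is_cring, of w] by (simp add: nf_irreducible r_neg minus_eq)
  next
    case False
    then obtain u x y v where w: "w = u @ x # y # v" "y < x" "nf w = red u x y v"
      using nf_descent less by blast
    have X: "x \<in> X" "y \<in> X" using less(2) w by auto
    note C = coeff_closed[OF X w(2)]
    have 1: "(\<lambda>s. single R (u @ y # x # v) s \<ominus> nf (u @ y # x # v) s) \<in> I"
      "(\<lambda>s. single R (u @ a x y # b x y # v) s \<ominus> nf (u @ a x y # b x y # v) s) \<in> I"
      using less(2) w partner[OF X w(2)] by (auto intro!: less(1) word_less_step)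
    have 2: "rel u x y v \<in> I" using less(2) w by (intro rel_in_I) auto
    have "(\<lambda>s. rel u x y v s \<oplus> (c x y \<otimes> (single R (u @ y # x # v) s \<ominus> nf (u @ y # x # v) s)
        \<oplus> d x y \<otimes> (single R (u @ a x y # b x y # v) s \<ominus> nf (u @ a x y # b x y # v) s))) \<in> I"
      by (intro I_add 2 I_smult 1 C)
    also have "(\<lambda>s. rel u x y v s \<oplus> (c x y \<otimes> (single R (u @ y # x # v) s \<ominus> nf (u @ y # x # v) s)
        \<oplus> d x y \<otimes> (single R (u @ a x y # b x y # v) s \<ominus> nf (u @ a x y # b x y # v) s)))
        = (\<lambda>s. single R w s \<ominus> nf w s)"
    proof
      fix s
      show "rel u x y v s \<oplus> (c x y \<otimes> (single R (u @ y # x # v) s \<ominus> nf (u @ y # x # v) s)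
        \<oplus> d x y \<otimes> (single R (u @ a x y # b x y # v) s \<ominus> nf (u @ a x y # b x y # v) s))
        = single R w s \<ominus> nf w s"
        unfolding w(3) unfolding w(1) red_def rel_def
        by (intro telescope C single_closed[OF is_cring] nf_closed)
    qed
    finally show ?thesis .
  qed
qed

text \<open>The linear extension of \<open>nf\<close>, one coefficient at a time.\<close>

definition reduct :: "('x list \<Rightarrow> 'a) \<Rightarrow> 'x list \<Rightarrow> 'a" where
  "reduct f = (\<lambda>s. lin (\<lambda>w. nf w s) f)"

lemma reduct:
  assumes "f \<in> fin_supp R (lists X)"
  shows "reduct f \<in> fin_supp R {s \<in> lists X. sorted s} \<and> (\<lambda>s. f s \<ominus> reduct f s) \<in> I"
  using assms
proof (induction f rule: fin_supp_induct)
  case zero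
  then show ?case using I_zero by (simp add: reduct_def fin_supp_zero[OF is_cring] minus_eq)
next
  case (add f k w)
  have S: "single R w \<in> fin_supp R (lists X)" using add(3) by (rule fin_supp_single[OF is_cring])
  have r: "reduct (\<lambda>y. f y \<oplus> k \<otimes> single R w y) = (\<lambda>s. reduct f s \<oplus> k \<otimes> nf w s)"
    by (simp add: reduct_def lin_add[OF add(1) fin_supp_smult[OF is_cring add(2) S] nf_closed]
        lin_smult[OF S add(2) nf_closed] lin_single nf_closed)
  have c: "reduct f s \<in> carrier R" "f s \<in> carrier R" "single R w s \<in> carrier R" "nf w s \<in> carrier R" for s
    unfolding reduct_def using lin_closed[OF add(1) nf_closed] fin_supp_closed[OF add(1)]
      single_closed[OF is_cring] nf_closed by auto
  have "(\<lambda>s. (f s \<ominus> reduct f s) \<oplus> k \<otimes> (single R w s \<ominus> nf w s)) \<in> I"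
    using add by (intro I_add I_smult nf_congruent) auto
  also have "(\<lambda>s. (f s \<ominus> reduct f s) \<oplus> k \<otimes> (single R w s \<ominus> nf w s))
      = (\<lambda>s. f s \<oplus> k \<otimes> single R w s \<ominus> (reduct f s \<oplus> k \<otimes> nf w s))"
    using c add(2) by (simp add: minus_eq minus_add r_distr r_minus a_ac)
  finally show ?case unfolding r
    using add by (auto intro!: fin_supp_add[OF is_cring] fin_supp_smult[OF is_cring] nf_fin_supp)
qed

text \<open>\<open>reduct f\<close> represents the coset of \<open>f\<close>. If \<open>g\<close> is
  another representative on sorted words, then \<open>f\<close> and \<open>g\<close> have the same
  reduct by \<open>I_annihilated\<close>, and the reduct of \<open>g\<close> is \<open>g\<close>
  because sorted words are their own normal forms.\<close>

lemma sorted_words_basis: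
  "is_free_basis R U {s \<in> lists X. sorted s} (U_monomial R X T br)"
  unfolding is_free_basis_def
proof (intro conjI ballI module_U)
  show "U_monomial R X T br \<in> {s \<in> lists X. sorted s} \<rightarrow> carrier U"
    by (auto simp: U_monomial_eq carrier_U single_A)
next
  let ?J = "{s \<in> lists X. sorted s}"
  have J: "?J \<subseteq> lists X" by auto
  have cA: "g \<in> carrier A" if "g \<in> fin_supp R ?J" for g
    using fin_supp_mono[OF that J] by (simp add: tensor_algebra_simps)
  fix x assume "x \<in> carrier U"
  then obtain f where f: "f \<in> carrier A" "x = I +>\<^bsub>A\<^esub> f" unfolding carrier_U by blast
  have rf: "reduct f \<in> fin_supp R ?J" "(\<lambda>s. f s \<ominus> reduct f s) \<in> I"
    using reduct f(1) by (auto simp: tensor_algebra_simps)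
  show "\<exists>!c. c \<in> fin_supp R ?J \<and> x = (\<Oplus>\<^bsub>U\<^esub>j\<in>{j. c j \<noteq> \<zero>}. c j \<odot>\<^bsub>U\<^esub> U_monomial R X T br j)"
  proof (rule ex1I[of _ "reduct f"])
    show "reduct f \<in> fin_supp R ?J \<and>
      x = (\<Oplus>\<^bsub>U\<^esub>j\<in>{j. reduct f j \<noteq> \<zero>}. reduct f j \<odot>\<^bsub>U\<^esub> U_monomial R X T br j)"
      using rf f finsum_monomials[OF rf(1) J] coset_eqI[OF f(1) cA[OF rf(1)] rf(2)] by simp
  next
    fix g assume g: "g \<in> fin_supp R ?J \<and> x = (\<Oplus>\<^bsub>U\<^esub>j\<in>{j. g j \<noteq> \<zero>}. g j \<odot>\<^bsub>U\<^esub> U_monomial R X T br j)"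
    then have "x = I +>\<^bsub>A\<^esub> g" using finsum_monomials[OF _ J] by simp
    then have "(\<lambda>w. f w \<ominus> g w) \<in> annihilated"
      using coset_eqD[OF f(1) cA, of g] g f(2) I_annihilated by auto
    then have "lin (\<lambda>w. nf ([] @ w @ []) s) (\<lambda>w. f w \<ominus> g w) = \<zero>" for s
      unfolding annihilated_def using lists.Nil[of X] by blast
    then have 0: "lin (\<lambda>w. nf w s) (\<lambda>w. f w \<ominus> g w) = \<zero>" for s by simp
    have gA: "g \<in> fin_supp R (lists X)" "f \<in> fin_supp R (lists X)"
      using cA[of g] g f(1) by (auto simp: tensor_algebra_simps)
    show "g = reduct f"
    proof
      fix s
      have "lin (\<lambda>w. nf w s) f = lin (\<lambda>w. nf w s) g"
        using 0[of s] lin_minus[OF gA(2,1), of "\<lambda>w. nf w s"] lin_closed[OF gA(1), of "\<lambda>w. nf w s"]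
          lin_closed[OF gA(2), of "\<lambda>w. nf w s"] by (simp add: nf_closed minus_zero_eq)
      \<comment> \<open>On sorted words \<open>nf w s\<close> is 1 for \<open>w = s\<close> and 0
        otherwise, which is the coordinate functional at \<open>s\<close>.\<close>
      also have "\<dots> = lin (single R s) g"
        using g single_closed[OF is_cring]
        by (intro lin_cong[of _ ?J]) (auto simp: nf_irreducible single_def)
      also have "\<dots> = g s" by (rule lin_coeff[OF gA(1)])
      finally show "g s = reduct f s" by (simp add: reduct_def)
    qed
  qed
qed

end

subsection \<open>Confluence of the exchange relations\<close>

text \<open>The order on generators is the lexicographic order on pairs, a well-order on pairs of
  naturals, as the type of letters in \<open>rewriting\<close> requires.\<close>

lemma Z_less_iff: "Z_less x y \<longleftrightarrow> x < y"
  by (cases x; cases y) (auto simp: less_prod_def')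

text \<open>Here \<open>p'\<close> and \<open>\<delta>\<close> stand for \<open>p\<^sup>-\<^sup>1\<close> and \<open>p - q\<^sup>-\<^sup>1\<close>.\<close>

locale exchange = cring R for R :: "('a, 'c) ring_scheme" (structure) +
  fixes p p' q \<delta> :: 'a and e :: "nat \<Rightarrow> nat \<Rightarrow> 'a"
  assumes closed [simp]: "p \<in> carrier R" "p' \<in> carrier R" "q \<in> carrier R" "\<delta> \<in> carrier R"
      "e i j \<in> carrier R"
    and p_inv: "p \<otimes> p' = \<one>"
    and hecke: "q = p' \<oplus> \<delta> \<otimes> (p' \<otimes> q)"
    and sign: "e i j \<otimes> e i j = \<one>"
begin

text \<open>For arguments in decreasing order every \<open>e\<close> has its smaller index first.
  Equal signs are then syntactically equal and cancel without appeal to the symmetry of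
  \<open>e\<close>.\<close>

fun swap_coeff :: "gen \<Rightarrow> gen \<Rightarrow> 'a" where
  "swap_coeff (i, l) (u, v) = (if i = u then e v l \<otimes> p else if l = v then e u i \<otimes> q
     else if l < v then e u i \<otimes> (e l v \<otimes> (p' \<otimes> q)) else e v l \<otimes> e u i)"

fun side_coeff :: "gen \<Rightarrow> gen \<Rightarrow> 'a" where
  "side_coeff (i, l) (u, v) = (if u < i \<and> v < l then e v l \<otimes> \<delta> else \<zero>)"

text \<open>Where \<open>side_coeff\<close> vanishes, \<open>side_fst\<close> and \<open>side_snd\<close> are dummies, chosen such that \<open>side_fst x y < x\<close>.\<close>

fun side_fst :: "gen \<Rightarrow> gen \<Rightarrow> gen" where
  "side_fst (i, l) (u, v) = (if u < i \<and> v < l then (i, v) else (u, v))"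

fun side_snd :: "gen \<Rightarrow> gen \<Rightarrow> gen" where
  "side_snd (i, l) (u, v) = (if u < i \<and> v < l then (u, l) else (i, l))"

lemma cancel: "x \<in> carrier R \<Longrightarrow> p \<otimes> (p' \<otimes> x) = x" "x \<in> carrier R \<Longrightarrow> e i j \<otimes> (e i j \<otimes> x) = x"
  by (simp_all add: m_assoc[symmetric] p_inv sign)

text \<open>\<open>hecke\<close> multiplied by \<open>\<delta> \<otimes> (q \<otimes> x)\<close>, in
  the right-nested shape in which \<open>alg\<close> leaves the terms; \<open>x\<close> collects the
  signs and the value of \<open>f\<close>. It settles the overlaps with two rows and columns
  \<open>r < v < l\<close>.\<close>

lemma hecke_mult:
  assumes "x \<in> carrier R"
  shows "\<delta> \<otimes> (q \<otimes> (q \<otimes> x)) = \<delta> \<otimes> (p' \<otimes> (q \<otimes> x)) \<oplus> \<delta> \<otimes> (\<delta> \<otimes> (p' \<otimes> (q \<otimes> (q \<otimes> x))))"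
proof -
  let ?y = "\<delta> \<otimes> (q \<otimes> x)"
  have "q \<otimes> ?y = (p' \<oplus> \<delta> \<otimes> (p' \<otimes> q)) \<otimes> ?y"
    using arg_cong[OF hecke, of "\<lambda>t. t \<otimes> ?y"] .
  also have "\<dots> = p' \<otimes> ?y \<oplus> \<delta> \<otimes> (p' \<otimes> q) \<otimes> ?y" using assms by (simp add: l_distr)
  finally show ?thesis using assms by (simp add: m_ac)
qed

text \<open>The same relation with a further factor \<open>p' \<otimes> q\<close>, for the two
  exceptional overlaps with three rows and two columns.\<close>

lemma hecke_mult_mult:
  assumes "x \<in> carrier R"
  shows "\<delta> \<otimes> (p' \<otimes> (q \<otimes> (q \<otimes> (q \<otimes> x)))) =
    \<delta> \<otimes> (p' \<otimes> (p' \<otimes> (q \<otimes> (q \<otimes> x)))) \<oplus> \<delta> \<otimes> (\<delta> \<otimes> (p' \<otimes> (p' \<otimes> (q \<otimes> (q \<otimes> (q \<otimes> x))))))"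
  using hecke_mult[of "p' \<otimes> (q \<otimes> x)"] assms by (simp add: m_ac)

text \<open>Both sides are reduced to non-decreasing triples by the assumed equations, and the
  coefficients are compared. Only the relative order of the rows and of the columns matters, so
  finitely many patterns exhaust all overlaps.\<close>

lemma confluent_exchange:
  fixes f :: "gen \<Rightarrow> gen \<Rightarrow> gen \<Rightarrow> 'a"
  assumes X: "x \<in> Z_basis n m" "y \<in> Z_basis n m" "z \<in> Z_basis n m"
    and less: "y < x" "z < y" and f: "\<And>x y z. f x y z \<in> carrier R"
    and L: "\<And>x' y' z'. \<lbrakk>x' \<in> Z_basis n m; y' \<in> Z_basis n m; z' \<in> Z_basis n m; (x', y', z') < (x, y, z); y' < x'\<rbrakk> \<Longrightarrow>
        f x' y' z' = swap_coeff x' y' \<otimes> f y' x' z' \<oplus> side_coeff x' y' \<otimes> f (side_fst x' y') (side_snd x' y') z'"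
    and R: "\<And>x' y' z'. \<lbrakk>x' \<in> Z_basis n m; y' \<in> Z_basis n m; z' \<in> Z_basis n m; (x', y', z') < (x, y, z); z' < y'\<rbrakk> \<Longrightarrow>
        f x' y' z' = swap_coeff y' z' \<otimes> f x' z' y' \<oplus> side_coeff y' z' \<otimes> f x' (side_fst y' z') (side_snd y' z')"
  shows "swap_coeff x y \<otimes> f y x z \<oplus> side_coeff x y \<otimes> f (side_fst x y) (side_snd x y) z =
      swap_coeff y z \<otimes> f x z y \<oplus> side_coeff y z \<otimes> f x (side_fst y z) (side_snd y z)"
proof -
  obtain i l u v w r where xyz: "x = (i, l)" "y = (u, v)" "z = (w, r)"
    by (metis surj_pair)
  have rng: "0 < i" "i \<le> n" "0 < u" "u \<le> n" "0 < w" "w \<le> n" "0 < l" "l \<le> m" "0 < v" "v \<le> m" "0 < r" "r \<le> m"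
    using X by (auto simp: xyz Z_basis_def)
  have Z: "(i', l') \<in> Z_basis n m \<longleftrightarrow> 0 < i' \<and> i' \<le> n \<and> 0 < l' \<and> l' \<le> m" for i' l'
    by (auto simp: Z_basis_def)
  \<comment> \<open>The assumed equations, separated by the relative position of the two generators:
    same row, same column, lower column in the higher row, and the remaining position, where the
    side term appears. \<open>L1\<close> to \<open>L4\<close> act on the first pair,
    \<open>R1\<close> to \<open>R4\<close> on the last; comparing indices decides which one
    fires.\<close>
  have L1: "f (i', l') (i', v') t = e v' l' \<otimes> p \<otimes> f (i', v') (i', l') t"
    if "(i', l') \<in> Z_basis n m" "(i', v') \<in> Z_basis n m" "t \<in> Z_basis n m" "v' < l'"
      "((i', l'), (i', v'), t) < ((i, l), (u, v), (w, r))" for i' l' v' t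
    using L[of "(i', l')" "(i', v')" t] that f by (simp add: xyz)
  have L2: "f (i', l') (u', l') t = e u' i' \<otimes> q \<otimes> f (u', l') (i', l') t"
    if "(i', l') \<in> Z_basis n m" "(u', l') \<in> Z_basis n m" "t \<in> Z_basis n m" "u' < i'"
      "((i', l'), (u', l'), t) < ((i, l), (u, v), (w, r))" for i' l' u' t
    using L[of "(i', l')" "(u', l')" t] that f by (simp add: xyz)
  have L3: "f (i', l') (u', v') t = e u' i' \<otimes> (e l' v' \<otimes> (p' \<otimes> q)) \<otimes> f (u', v') (i', l') t"
    if "(i', l') \<in> Z_basis n m" "(u', v') \<in> Z_basis n m" "t \<in> Z_basis n m" "u' < i'" "l' < v'"
      "((i', l'), (u', v'), t) < ((i, l), (u, v), (w, r))" for i' l' u' v' t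
    using L[of "(i', l')" "(u', v')" t] that f by (simp add: xyz)
  have L4: "f (i', l') (u', v') t = e v' l' \<otimes> e u' i' \<otimes> f (u', v') (i', l') t \<oplus> e v' l' \<otimes> \<delta> \<otimes> f (i', v') (u', l') t"
    if "(i', l') \<in> Z_basis n m" "(u', v') \<in> Z_basis n m" "t \<in> Z_basis n m" "u' < i'" "v' < l'"
      "((i', l'), (u', v'), t) < ((i, l), (u, v), (w, r))" for i' l' u' v' t
    using L[of "(i', l')" "(u', v')" t] that f by (simp add: xyz)
  have R1: "f t (i', l') (i', v') = e v' l' \<otimes> p \<otimes> f t (i', v') (i', l')"
    if "(i', l') \<in> Z_basis n m" "(i', v') \<in> Z_basis n m" "t \<in> Z_basis n m" "v' < l'"
      "(t, (i', l'), (i', v')) < ((i, l), (u, v), (w, r))" for i' l' v' t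
    using R[of t "(i', l')" "(i', v')"] that f by (simp add: xyz)
  have R2: "f t (i', l') (u', l') = e u' i' \<otimes> q \<otimes> f t (u', l') (i', l')"
    if "(i', l') \<in> Z_basis n m" "(u', l') \<in> Z_basis n m" "t \<in> Z_basis n m" "u' < i'"
      "(t, (i', l'), (u', l')) < ((i, l), (u, v), (w, r))" for i' l' u' t
    using R[of t "(i', l')" "(u', l')"] that f by (simp add: xyz)
  have R3: "f t (i', l') (u', v') = e u' i' \<otimes> (e l' v' \<otimes> (p' \<otimes> q)) \<otimes> f t (u', v') (i', l')"
    if "(i', l') \<in> Z_basis n m" "(u', v') \<in> Z_basis n m" "t \<in> Z_basis n m" "u' < i'" "l' < v'"
      "(t, (i', l'), (u', v')) < ((i, l), (u, v), (w, r))" for i' l' u' v' t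
    using R[of t "(i', l')" "(u', v')"] that f by (simp add: xyz)
  have R4: "f t (i', l') (u', v') = e v' l' \<otimes> e u' i' \<otimes> f t (u', v') (i', l') \<oplus> e v' l' \<otimes> \<delta> \<otimes> f t (i', v') (u', l')"
    if "(i', l') \<in> Z_basis n m" "(u', v') \<in> Z_basis n m" "t \<in> Z_basis n m" "u' < i'" "v' < l'"
      "(t, (i', l'), (u', v')) < ((i, l), (u, v), (w, r))" for i' l' u' v' t
    using R[of t "(i', l')" "(u', v')"] that f by (simp add: xyz)
  note red = L1 L2 L3 L4 R1 R2 R3 R4 Z rng f
  note alg = r_distr l_distr m_ac a_ac cancel sign f
  \<comment> \<open>The row patterns. Equal rows force decreasing columns, which leaves 1, 5, 5 and
    13 weak orderings of the three columns; 13 is the number of all of them.\<close>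
  consider "i = u" "u = w" "v < l" "r < v" | "i = u" "w < u" "v < l" | "u < i" "w = u" "r < v" | "u < i" "w < u"
    using less unfolding xyz by fastforce
  then show ?thesis
  proof cases
    case 1
    \<comment> \<open>In every pattern \<open>red\<close> brings the triples into non-decreasing
      order and \<open>alg\<close> then compares the coefficients.\<close>
    then show ?thesis unfolding xyz by (simp add: red) (simp add: alg)
  next
    case 2
    note outer = this
    consider "r < v" | "r = v" | "v < r" "r < l" | "r = l" | "l < r"
      using linorder_less_linear[of l v] linorder_less_linear[of v r] linorder_less_linear[of l r] by blast
    then show ?thesis
    proof cases
      case 1
      \<comment> \<open>The two reductions differ in coefficients with a factor
        \<open>\<delta>\<close>, which the Hecke-type relation reconciles.\<close>
      with outer show ?thesis unfolding xyz by (simp add: red) (simp add: alg, simp add: hecke_mult a_ac f)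
    next
      case 2
      with outer show ?thesis unfolding xyz by (simp add: red) (simp add: alg)
    next
      case 3
      with outer show ?thesis unfolding xyz by (simp add: red) (simp add: alg)
    next
      case 4
      with outer show ?thesis unfolding xyz by (simp add: red) (simp add: alg)
    next
      case 5
      with outer show ?thesis unfolding xyz by (simp add: red) (simp add: alg)
    qed
  next
    case 3
    note outer = this
    consider "v < l" | "l < r" | "l = r" | "r < l" "l < v" | "l = v"
      using linorder_less_linear[of l v] linorder_less_linear[of v r] linorder_less_linear[of l r] by blast
    then show ?thesis
    proof cases
      case 1
      with outer show ?thesis unfolding xyz by (simp add: red) (simp add: alg, simp add: hecke_mult a_ac f)
    next
      case 2
      with outer show ?thesis unfolding xyz by (simp add: red) (simp add: alg)
    next
      case 3
      with outer show ?thesis unfolding xyz by (simp add: red) (simp add: alg)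
    next
      case 4
      with outer show ?thesis unfolding xyz by (simp add: red) (simp add: alg)
    next
      case 5
      with outer show ?thesis unfolding xyz by (simp add: red) (simp add: alg)
    qed
  next
    case 4
    note outer = this
    consider "v = r" "v < l" | "l = v" "r < v" | "l < v" "v < r" | "l < r" "r < v" | "v < l" "l < r" | "v < r" "r < l" | "r < l" "l < v" | "r < v" "v < l" | "l = v" "v < r" | "l = r" "v < r" | "l = r" "r < v" | "v = r" "l < v" | "l = v" "v = r"
      using linorder_less_linear[of l v] linorder_less_linear[of v r] linorder_less_linear[of l r] by blast
    then show ?thesis
    proof cases
      case 1
      with outer show ?thesis unfolding xyz by (simp add: red) (simp add: alg, simp add: hecke_mult_mult a_ac f)
    next
      case 2
      with outer show ?thesis unfolding xyz by (simp add: red) (simp add: alg, simp add: hecke_mult_mult a_ac f)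
    next
      case 3
      with outer show ?thesis unfolding xyz by (simp add: red) (simp add: alg)
    next
      case 4
      with outer show ?thesis unfolding xyz by (simp add: red) (simp add: alg)
    next
      case 5
      with outer show ?thesis unfolding xyz by (simp add: red) (simp add: alg)
    next
      case 6
      with outer show ?thesis unfolding xyz by (simp add: red) (simp add: alg)
    next
      case 7
      with outer show ?thesis unfolding xyz by (simp add: red) (simp add: alg)
    next
      case 8
      with outer show ?thesis unfolding xyz by (simp add: red) (simp add: alg)
    next
      case 9
      with outer show ?thesis unfolding xyz by (simp add: red) (simp add: alg)
    next
      case 10
      with outer show ?thesis unfolding xyz by (simp add: red) (simp add: alg)
    next
      case 11
      with outer show ?thesis unfolding xyz by (simp add: red) (simp add: alg)
    next
      case 12
      with outer show ?thesis unfolding xyz by (simp add: red) (simp add: alg)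
    next
      case 13
      with outer show ?thesis unfolding xyz by (simp add: red) (simp add: alg)
    qed
  qed
qed

end

section \<open>Values of \<open>T_map\<close> on basis tensors, and the proof of the theorem\<close>

context Z_data
begin

lemma lin_ext_single:
  assumes "z \<in> BB" "g \<in> BB \<rightarrow> fin_supp R BB"
  shows "lin_ext R (free_module R BB) g (single R z) = g z"
proof
  fix w
  have g: "g t w \<in> carrier R" if "t \<in> BB" for t using assms(2) that by (auto intro: fin_supp_closed)
  have "lin_ext R (free_module R BB) g (single R z) w = (\<Oplus>t \<in> BB. single R z t \<otimes> g t w)"
    by (simp only: lin_ext_free_module[OF is_cring finite_BB fin_supp_single[OF is_cring assms(1)] assms(2)])
  also have "\<dots> = (\<Oplus>t \<in> BB. if z = t then g t w else \<zero>)"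
    using g by (intro finsum_cong') (auto simp: single_def)
  also have "\<dots> = g z w" using g by (intro finsum_singleton assms(1) finite_BB) auto
  finally show "lin_ext R (free_module R BB) g (single R z) w = g z w" .
qed

lemma T_map_single:
  assumes "z \<in> BB"
  shows "T_map R p q \<epsilon> n m (single R z) = (\<lambda>w. S_on_basis R p q \<epsilon> z w \<oplus> pair_on_basis R p q \<epsilon> z w)"
  unfolding T_map_def S_map_def pair_map_def lin_ext_single[OF assms S_on_basis_closed]
    lin_ext_single[OF assms pair_on_basis_closed]
  by (simp add: free_module_def)

lemma T_map_single_closed:
  "z \<in> BB \<Longrightarrow> T_map R p q \<epsilon> n m (single R z) \<in> fin_supp R BB"
  unfolding T_map_single
  using S_on_basis_closed pair_on_basis_closed by (intro fin_supp_add[OF is_cring]) auto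

end

context exchange
begin

lemma coeff_closed: "swap_coeff x y \<in> carrier R" "side_coeff x y \<in> carrier R"
  by (cases x; cases y; simp)+

lemma partner:
  assumes "x \<in> Z_basis n m" "y \<in> Z_basis n m" "y < x"
  shows "side_fst x y \<in> Z_basis n m" "side_snd x y \<in> Z_basis n m" "side_fst x y < x"
  using assms by (cases x; cases y; auto simp: Z_basis_def)+

end

theorem corollary9p3:
  fixes k :: "('a, 'c) ring_scheme"
    and p q :: 'a and \<epsilon> :: "nat \<Rightarrow> nat \<Rightarrow> 'a" and \<alpha> n m :: nat
  assumes "cring k"
    and "p \<in> Units k" and "q \<in> Units k" and "p \<otimes>\<^bsub>k\<^esub> q \<noteq> \<one>\<^bsub>k\<^esub>"
    and "\<alpha> \<ge> 1"
    and "\<And>i j. 1 \<le> i \<Longrightarrow> i < j \<Longrightarrow> j \<le> \<alpha> \<Longrightarrow> \<epsilon> i j = \<one>\<^bsub>k\<^esub> \<or> \<epsilon> i j = \<ominus>\<^bsub>k\<^esub> \<one>\<^bsub>k\<^esub>"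
    and "\<And>i. 1 \<le> i \<Longrightarrow> i \<le> \<alpha> \<Longrightarrow> \<epsilon> i i = \<one>\<^bsub>k\<^esub>"
    and "\<And>i j. 1 \<le> i \<Longrightarrow> i < j \<Longrightarrow> j \<le> \<alpha> \<Longrightarrow> \<epsilon> j i = \<epsilon> i j"
    and "1 \<le> n" and "n \<le> \<alpha>" and "1 \<le> m" and "m \<le> \<alpha>"
  shows "is_free_basis k (M_alg k p q \<epsilon> n m) (Z_nondecreasing n m) (M_monomial k p q \<epsilon> n m)"
proof -
  interpret cring k by fact
  \<comment> \<open>\<open>\<epsilon>\<close> is unconstrained outside \<open>{1..\<alpha>}\<close>; extending it by 1 spares all range conditions.\<close>
  define e where "e i j = (if i \<in> {1..\<alpha>} \<and> j \<in> {1..\<alpha>} then \<epsilon> i j else \<one>\<^bsub>k\<^esub>)" for i j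
  have \<epsilon>_cases: "(\<epsilon> i j = \<one>\<^bsub>k\<^esub> \<or> \<epsilon> i j = \<ominus>\<^bsub>k\<^esub> \<one>\<^bsub>k\<^esub>) \<and> \<epsilon> j i = \<epsilon> i j"
    if "1 \<le> i" "i \<le> \<alpha>" "1 \<le> j" "j \<le> \<alpha>" for i j
  proof (cases i j rule: linorder_cases)
    case less
    then show ?thesis using assms(6,8)[OF that(1) less that(4)] by metis
  next
    case equal
    then show ?thesis using assms(7)[OF that(1,2)] by simp
  next
    case greater
    then show ?thesis using assms(6,8)[OF that(3) greater that(2)] by metis
  qed
  then have e: "e i j = \<one>\<^bsub>k\<^esub> \<or> e i j = \<ominus>\<^bsub>k\<^esub> \<one>\<^bsub>k\<^esub>" for i j
    unfolding e_def by (metis atLeastAtMost_iff)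
  \<comment> \<open>Both index orders are needed, since \<open>S_coeff\<close> does not always put
    the smaller index first while \<open>swap_coeff\<close> does.\<close>
  have e_swap: "\<epsilon> i j = e i j" "\<epsilon> i j = e j i" if "1 \<le> i" "i \<le> max n m" "1 \<le> j" "j \<le> max n m" for i j
  proof -
    have r: "i \<le> \<alpha>" "j \<le> \<alpha>" using that assms(10,12) by linarith+
    have "\<epsilon> j i = \<epsilon> i j" using \<epsilon>_cases[OF that(1) r(1) that(3) r(2)] by blast
    then show "\<epsilon> i j = e i j" "\<epsilon> i j = e j i" using that r by (simp_all add: e_def)
  qed
  have mone: "\<ominus>\<^bsub>k\<^esub> \<one>\<^bsub>k\<^esub> \<otimes>\<^bsub>k\<^esub> \<ominus>\<^bsub>k\<^esub> \<one>\<^bsub>k\<^esub> = \<one>\<^bsub>k\<^esub>" by (simp add: l_minus)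
  have sign: "e i j \<otimes>\<^bsub>k\<^esub> e i j = \<one>\<^bsub>k\<^esub>" "e i j \<in> carrier k" for i j
    using e[of i j] mone by auto
  interpret Z: Z_data k p q \<epsilon> n m
  proof
    fix i j assume "1 \<le> i" "i \<le> max n m" "1 \<le> j" "j \<le> max n m"
    then have "\<epsilon> i j \<otimes>\<^bsub>k\<^esub> \<epsilon> i j = \<one>\<^bsub>k\<^esub>" "\<epsilon> i j \<in> carrier k" using sign[of i j] e_swap(1)[of i j] by auto
    then show "\<epsilon> i j \<in> Units k" by (auto simp: Units_def)
  qed (use assms in auto)
  let ?p' = "inv\<^bsub>k\<^esub> p" and ?\<delta> = "p \<ominus>\<^bsub>k\<^esub> inv\<^bsub>k\<^esub> q"
  have u: "p \<in> carrier k" "?p' \<in> carrier k" "q \<in> carrier k" "inv\<^bsub>k\<^esub> q \<in> carrier k"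
    using assms(2,3) by auto
  interpret E: exchange k p ?p' q ?\<delta> e
  proof
    \<comment> \<open>Expanding (p - q^-1) p^-1 q leaves q - p^-1.\<close>
    have "?\<delta> \<otimes>\<^bsub>k\<^esub> (?p' \<otimes>\<^bsub>k\<^esub> q) =
        p \<otimes>\<^bsub>k\<^esub> (?p' \<otimes>\<^bsub>k\<^esub> q) \<ominus>\<^bsub>k\<^esub> inv\<^bsub>k\<^esub> q \<otimes>\<^bsub>k\<^esub> (?p' \<otimes>\<^bsub>k\<^esub> q)"
      using u by (simp add: minus_eq l_distr l_minus)
    also have "p \<otimes>\<^bsub>k\<^esub> (?p' \<otimes>\<^bsub>k\<^esub> q) = q" using u assms(2) by (simp flip: m_assoc)
    also have "inv\<^bsub>k\<^esub> q \<otimes>\<^bsub>k\<^esub> (?p' \<otimes>\<^bsub>k\<^esub> q) = ?p'" using u assms(3) by (simp add: m_lcomm)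
    finally show "q = ?p' \<oplus>\<^bsub>k\<^esub> ?\<delta> \<otimes>\<^bsub>k\<^esub> (?p' \<otimes>\<^bsub>k\<^esub> q)"
      using u by (simp add: minus_eq a_lcomm r_neg)
  qed (use u sign assms(2) in auto)
  let ?B = "Z_basis n m" and ?T = "T_map k p q \<epsilon> n m"
  have c: "S_coeff k p q \<epsilon> x y = E.swap_coeff x y" if "x \<in> ?B" "y \<in> ?B" "y < x" for x y
  proof -
    obtain i l u v where xy: "x = (i, l)" "y = (u, v)" by fastforce
    have "\<epsilon> v l = e v l" "\<epsilon> v l = e l v" "\<epsilon> u i = e u i" "\<epsilon> i u = e u i"
      using that by (auto simp: xy Z_basis_def intro!: e_swap)
    then show ?thesis using u sign by (simp add: xy S_coeff.simps m_assoc)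
  qed
  have d: "pair_pos k p q \<epsilon> x y = (\<lambda>z. E.side_coeff x y \<otimes>\<^bsub>k\<^esub> single k (E.side_fst x y, E.side_snd x y) z)"
    if "x \<in> ?B" "y \<in> ?B" for x y
  proof -
    obtain i l u v where xy: "x = (i, l)" "y = (u, v)" by fastforce
    have "\<epsilon> v l = e v l" using that by (auto simp: xy Z_basis_def intro!: e_swap)
    then show ?thesis
      by (auto simp: xy pair_pos.simps free_module_def fun_eq_iff single_closed[OF assms(1)])
  qed
  have T_greater: "?T (single k (x, y)) = (\<lambda>z. E.swap_coeff x y \<otimes>\<^bsub>k\<^esub> single k (y, x) z \<oplus>\<^bsub>k\<^esub>
      E.side_coeff x y \<otimes>\<^bsub>k\<^esub> single k (E.side_fst x y, E.side_snd x y) z)"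
    if "x \<in> ?B" "y \<in> ?B" "y < x" for x y
    using that c[OF that] d[OF that(1,2)] less_imp_neq[OF that(3)] less_not_sym[OF that(3)]
    by (simp add: Z.T_map_single S_on_basis_def pair_on_basis_def Z_less_iff) (simp add: free_module_def)
  have T_less: "?T (single k (y, x)) = (\<lambda>z. inv\<^bsub>k\<^esub> (E.swap_coeff x y) \<otimes>\<^bsub>k\<^esub> single k (x, y) z \<oplus>\<^bsub>k\<^esub>
      (\<ominus>\<^bsub>k\<^esub> (inv\<^bsub>k\<^esub> (E.swap_coeff x y))) \<otimes>\<^bsub>k\<^esub> (E.side_coeff x y \<otimes>\<^bsub>k\<^esub> single k (E.side_fst x y, E.side_snd x y) z))"
    if "x \<in> ?B" "y \<in> ?B" "y < x" for x y
    using that c[OF that] d[OF that(1,2)] less_imp_neq[OF that(3)] less_not_sym[OF that(3)]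
    by (simp add: Z.T_map_single S_on_basis_def pair_on_basis_def Z_less_iff) (simp add: free_module_def)
  interpret Q: quadratic_algebra k ?B ?T "zero_bracket k n m" E.swap_coeff E.side_coeff E.side_fst E.side_snd
  proof unfold_locales
    fix x y assume xy: "x \<in> ?B" "y \<in> ?B"
    show "?T (single k (x, y)) \<in> fin_supp k (?B \<times> ?B)" using xy by (intro Z.T_map_single_closed) auto
    show "zero_bracket k n m (single k (x, y)) \<in> fin_supp k ?B"
      "zero_bracket k n m (single k (x, y)) = (\<lambda>_. \<zero>\<^bsub>k\<^esub>)"
      by (simp_all add: zero_bracket_def free_module_def fin_supp_zero[OF assms(1)])
    assume less: "y < x"
    show "?T (single k (x, y)) = (\<lambda>z. E.swap_coeff x y \<otimes>\<^bsub>k\<^esub> single k (y, x) z \<oplus>\<^bsub>k\<^esub>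
      E.side_coeff x y \<otimes>\<^bsub>k\<^esub> single k (E.side_fst x y, E.side_snd x y) z)"
      by (rule T_greater[OF xy less])
    have U: "E.swap_coeff x y \<in> Units k" using Z.S_coeff_Units[of x y] xy c[OF xy less] by simp
    \<comment> \<open>Writing s and d for the two coefficients and (a, b) for the side pair, the
      relation of (y, x) is yx - s^-1 xy + s^-1 d ab, which is -s^-1 times xy - s yx - d ab. This
      gives the factor that \<open>T_less\<close> in \<open>quadratic_algebra\<close> asks
      for.\<close>
    have "single k (y, x) z \<ominus>\<^bsub>k\<^esub> ?T (single k (y, x)) z
        = (\<ominus>\<^bsub>k\<^esub> (inv\<^bsub>k\<^esub> (E.swap_coeff x y))) \<otimes>\<^bsub>k\<^esub> (single k (x, y) z \<ominus>\<^bsub>k\<^esub> ?T (single k (x, y)) z)" for z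
    proof -
      have "inv\<^bsub>k\<^esub> (E.swap_coeff x y) \<otimes>\<^bsub>k\<^esub> (E.swap_coeff x y \<otimes>\<^bsub>k\<^esub> single k (y, x) z) = single k (y, x) z"
        using U E.coeff_closed[of x y] single_closed[OF assms(1), of "(y, x)" z]
        by (simp flip: m_assoc)
      then show ?thesis
        using U E.coeff_closed[of x y] single_closed[OF assms(1), of "(y, x)" z]
          single_closed[OF assms(1), of "(x, y)" z] single_closed[OF assms(1), of "(E.side_fst x y, E.side_snd x y)" z]
        unfolding T_less[OF xy less] T_greater[OF xy less]
        by (simp add: minus_eq minus_add r_distr l_minus r_minus a_ac)
    qed
    then show "\<exists>c \<in> carrier k. \<forall>z. single k (y, x) z \<ominus>\<^bsub>k\<^esub> ?T (single k (y, x)) z =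
      c \<otimes>\<^bsub>k\<^esub> (single k (x, y) z \<ominus>\<^bsub>k\<^esub> ?T (single k (x, y)) z)"
      using U by (intro bexI[of _ "\<ominus>\<^bsub>k\<^esub> (inv\<^bsub>k\<^esub> (E.swap_coeff x y))"]) auto
  next
    fix x assume "x \<in> ?B"
    then show "?T (single k (x, x)) = single k (x, x)"
      by (simp add: Z.T_map_single S_on_basis_def pair_on_basis_def)
        (simp add: free_module_def single_closed[OF assms(1)])
  qed (rule E.coeff_closed | fact E.partner E.confluent_exchange)+
  have "(\<lambda>x y :: gen. x = y \<or> Z_less x y) = (\<le>)"
    by (intro ext) (metis Z_less_iff le_less)
  then have "Z_nondecreasing n m = {s \<in> lists ?B. sorted s}"
    by (simp add: Z_nondecreasing_def)
  then show ?thesis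
    using Q.sorted_words_basis by (simp add: M_alg_def M_monomial_def[abs_def])
qed

end
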